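(* Let $T>0$, $n\in\mathbb{N}$, $h=T/n$. Then the inf-sup stability condition $$c_S\,\|u_h\|_{L^2(0,T)}\le\sup_{0\ne v_h\in S_h^0(0,T)}\frac{\langle u_h,\mathcal{H}_Tv_h\rangle_{L^2(0,T)}}{\|v_h\|_{L^2(0,T)}}\quad\text{for all }u_h\in S_h^0(0,T)$$ holds true with $$c_S:=\min_{u_h\in S_h^0(0,T)}c_S(u_h)=\frac1T\,\frac{2\sqrt3}{\pi^2}\,\frac{8}{(2+\frac1n)^2}\,h ,$$ the minimum corresponding to the value $M=n-1$ in the definition of $c_S(u_h)$. In particular, for $T=2$, $$\lim_{n\to\infty}\frac12\,\frac{2\sqrt3}{\pi^2}\,\frac{8}{(2+\frac1n)^2}=\frac{2\sqrt3}{\pi^2}\simeq 0.351 .$$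
   Context: For $T>0$ and $n\in\mathbb{N}=\{1,2,\dots\}$ let $h=T/n$ and $t_i=ih$ for $i=0,\dots,n$. $S_h^0(0,T)\subset L^2(0,T)$ is the space of functions that are constant on each element $(t_{i-1},t_i)$, $i=1,\dots,n$. Modified Hilbert transformation: every $v\in L^2(0,T)$ has the expansion $v(t)=\sum_{k=0}^\infty v_k\sin\big((\frac\pi2+k\pi)\frac tT\big)$ with $v_k=\frac2T\int_0^Tv(t)\sin\big((\frac\pi2+k\pi)\frac tT\big)\,dt$, and $\mathcal{H}_T:L^2(0,T)\to L^2(0,T)$ is defined by $(\mathcal{H}_Tv)(t)=\sum_{k=0}^\infty v_k\cos\big((\frac\pi2+k\pi)\frac tT\big)$. For $u_h\in S_h^0(0,T)$ let $\overline{u}_k=\frac2T\int_0^Tu_h(t)\cos\big((\frac\pi2+k\pi)\frac tT\big)\,dt$, $k\in\mathbb{N}_0$, and define $$c_S(u_h):=\frac{2\sqrt3}{\pi^2}\,\frac{16n^2-8n(2M+1)}{(4n-(2M+1))^2},\qquad M:=\min\Big\{m\in\mathbb{N}_0:\ \|u_h\|_{L^2(0,T)}^2\le\frac T2\,\frac{\pi^2}{3}\sum_{k=0}^m\overline{u}_k^2\Big\},$$ where $M\le n-1$ always holds. *)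

theory Defs
  imports "HOL-Analysis.Analysis"
begin

text \<open>
  Elements of \<open>L\<^sup>2(0,T)\<close> are represented by real functions on the whole line; only their values on
  the open interval \<open>(0,T)\<close> matter, and two representatives denote the same element iff the
  \<open>L\<^sup>2\<close> norm of their difference is \<open>0\<close>. In particular \<open>v \<noteq> 0\<close> in \<open>L\<^sup>2(0,T)\<close> is \<open>L2_norm T v \<noteq> 0\<close>.
\<close>

definition L2_space :: "real \<Rightarrow> (real \<Rightarrow> real) set" where
  "L2_space T = {v. set_borel_measurable lborel {0<..<T} v \<and>
                    set_integrable lborel {0<..<T} (\<lambda>t. (v t)\<^sup>2)}"

definition L2_inner :: "real \<Rightarrow> (real \<Rightarrow> real) \<Rightarrow> (real \<Rightarrow> real) \<Rightarrow> real" where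
  "L2_inner T u v = (LINT t:{0<..<T}|lborel. u t * v t)"

definition L2_norm :: "real \<Rightarrow> (real \<Rightarrow> real) \<Rightarrow> real" where
  "L2_norm T v = sqrt (L2_inner T v v)"

definition step_space :: "real \<Rightarrow> nat \<Rightarrow> (real \<Rightarrow> real) set" where
  "step_space T n = {v \<in> L2_space T.
     \<forall>i\<in>{1..n}. v constant_on {real (i - 1) * (T / real n)<..<real i * (T / real n)}}"

definition freq :: "real \<Rightarrow> nat \<Rightarrow> real" where
  "freq T k = (pi / 2 + real k * pi) / T"

definition sin_coeff_T :: "real \<Rightarrow> (real \<Rightarrow> real) \<Rightarrow> nat \<Rightarrow> real" where
  "sin_coeff_T T v k = 2 / T * (LINT t:{0<..<T}|lborel. v t * sin (freq T k * t))"

definition cos_coeff_T :: "real \<Rightarrow> (real \<Rightarrow> real) \<Rightarrow> nat \<Rightarrow> real" where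
  "cos_coeff_T T u k = 2 / T * (LINT t:{0<..<T}|lborel. u t * cos (freq T k * t))"

text \<open>
  The cosine series converges in \<open>L\<^sup>2(0,T)\<close>, which determines its sum up to a null set;
  \<open>SOME\<close> picks a representative of that class.
\<close>

definition modified_Hilbert :: "real \<Rightarrow> (real \<Rightarrow> real) \<Rightarrow> real \<Rightarrow> real" where
  "modified_Hilbert T v = (SOME w. w \<in> L2_space T \<and>
     (\<lambda>N. L2_norm T (\<lambda>t. w t - (\<Sum>k<N. sin_coeff_T T v k * cos (freq T k * t)))) \<longlonglongrightarrow> 0)"

definition M_index :: "real \<Rightarrow> (real \<Rightarrow> real) \<Rightarrow> nat" where
  "M_index T u = (LEAST m. (L2_norm T u)\<^sup>2 \<le> T / 2 * (pi\<^sup>2 / 3) * (\<Sum>k\<le>m. (cos_coeff_T T u k)\<^sup>2))"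

definition c_S :: "real \<Rightarrow> nat \<Rightarrow> (real \<Rightarrow> real) \<Rightarrow> real" where
  "c_S T n u = 2 * sqrt 3 / pi\<^sup>2 *
     ((16 * (real n)\<^sup>2 - 8 * real n * (2 * real (M_index T u) + 1)) /
      (4 * real n - (2 * real (M_index T u) + 1))\<^sup>2)"

definition c_S_min :: "real \<Rightarrow> nat \<Rightarrow> real" where
  "c_S_min T n = (LEAST c. c \<in> c_S T n ` step_space T n)"

end

theory Submission
  imports Defs
begin

text \<open>
  On step functions, the mode \<open>cos (freq T k * t)\<close> acts through its samples at the element
  midpoints, damped by \<open>sin \<theta>\<^sub>k / \<theta>\<^sub>k\<close> with \<open>\<theta>\<^sub>k = (2k + 1)\<pi> / 4n\<close>. The sampled cosines of the modes
  \<open>k < n\<close> are an orthogonal basis of the step functions (DCT-IV), and so are the sampled sines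
  (DST-IV). Since \<open>(sin \<theta>\<^sub>k / \<theta>\<^sub>k)\<^sup>2 \<ge> 4 / \<pi>\<^sup>2\<close> for \<open>k < n\<close>, the first \<open>n\<close> coefficients already give
  \<open>M \<le> n - 1\<close>, with equality for the sampled cosine of mode \<open>n - 1\<close>.

  For the inf-sup bound, test \<open>u\<close> with the step function \<open>v\<close> whose discrete sine transform is the
  discrete cosine transform of \<open>u\<close>; then \<open>\<parallel>v\<parallel> = \<parallel>u\<parallel>\<close>. By aliasing, the modes \<open>2nl + k\<close> and
  \<open>2nl + 2n - 1 - k\<close> together contribute a nonnegative multiple of
  \<open>1 / (\<pi>l + \<theta>\<^sub>k)\<^sup>2 - 1 / (\<pi>(l + 1) - \<theta>\<^sub>k)\<^sup>2\<close> to \<open>\<langle>u, H v\<rangle>\<close>, and the terms with \<open>l = 0\<close> suffice.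
\<close>

subsection \<open>The space \<open>L\<^sup>2(0,T)\<close>\<close>

text \<open>Absorbing the interval into the measure turns set integrals into plain integrals over a
  finite measure, so that the general facts on \<open>integrable\<close> and
  \<open>nn_integral\<close> apply.\<close>

abbreviation interval_measure :: "real \<Rightarrow> real measure" where
  "interval_measure T \<equiv> restrict_space lborel {0<..<T}"

lemma L2_space_iff:
  "v \<in> L2_space T \<longleftrightarrow>
     v \<in> borel_measurable (interval_measure T) \<and> integrable (interval_measure T) (\<lambda>t. (v t)\<^sup>2)"
  by (simp add: L2_space_def set_borel_measurable_def set_integrable_def
      borel_measurable_restrict_space_iff integrable_restrict_space)

lemma L2_inner_eq: "L2_inner T u v = (LINT t|interval_measure T. u t * v t)"
  by (simp add: L2_inner_def set_lebesgue_integral_def integral_restrict_space)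

lemma finite_measure_interval: "finite_measure (interval_measure T)"
proof (rule finite_measureI)
  show "emeasure (interval_measure T) (space (interval_measure T)) \<noteq> \<infinity>"
    by (cases "0 \<le> T") (simp_all add: emeasure_restrict_space space_restrict_space)
qed

lemma L2_spaceI_bounded:
  assumes "v \<in> borel_measurable (interval_measure T)" "\<And>t. \<bar>v t\<bar> \<le> B"
  shows "v \<in> L2_space T"
proof -
  interpret finite_measure "interval_measure T" by (rule finite_measure_interval)
  have "norm ((v t)\<^sup>2) \<le> B\<^sup>2" for t
    using abs_le_square_iff[of "v t" B] assms(2)[of t] by simp
  then show ?thesis
    unfolding L2_space_iff using assms(1)
    by (auto intro!: integrable_const_bound[where B="B\<^sup>2"])
qed

lemma L2_mult_integrable:
  assumes "u \<in> L2_space T" "v \<in> L2_space T"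
  shows "integrable (interval_measure T) (\<lambda>t. u t * v t)"
proof (rule Bochner_Integration.integrable_bound)
  show "integrable (interval_measure T) (\<lambda>t. (u t)\<^sup>2 + (v t)\<^sup>2)"
    using assms by (auto simp: L2_space_iff)
  show "(\<lambda>t. u t * v t) \<in> borel_measurable (interval_measure T)"
    using assms by (auto simp: L2_space_iff)
  have "norm (u t * v t) \<le> norm ((u t)\<^sup>2 + (v t)\<^sup>2)" for t
    using sum_squares_bound[of "\<bar>u t\<bar>" "\<bar>v t\<bar>"] mult_nonneg_nonneg[of "\<bar>u t\<bar>" "\<bar>v t\<bar>"]
    by (simp add: abs_mult del: mult_nonneg_nonneg)
  then show "AE t in interval_measure T. norm (u t * v t) \<le> norm ((u t)\<^sup>2 + (v t)\<^sup>2)" by simp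
qed

lemma L2_space_add:
  assumes "u \<in> L2_space T" "v \<in> L2_space T"
  shows "(\<lambda>t. u t + v t) \<in> L2_space T"
  using assms L2_mult_integrable[OF assms]
  by (auto simp: L2_space_iff power2_sum mult.assoc)

lemma L2_space_scale: "v \<in> L2_space T \<Longrightarrow> (\<lambda>t. c * v t) \<in> L2_space T"
  by (auto simp: L2_space_iff power_mult_distrib)

lemma L2_space_diff:
  assumes "u \<in> L2_space T" "v \<in> L2_space T"
  shows "(\<lambda>t. u t - v t) \<in> L2_space T"
  using L2_space_add[OF assms(1) L2_space_scale[OF assms(2), of "-1"]] by simp

lemma L2_space_sum:
  "(\<And>k. k \<in> A \<Longrightarrow> f k \<in> L2_space T) \<Longrightarrow> (\<lambda>t. \<Sum>k\<in>A. f k t) \<in> L2_space T"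
  by (induction A rule: infinite_finite_induct)
    (auto intro: L2_space_add L2_spaceI_bounded[where B=0])

lemma L2_space_continuous_bounded:
  assumes "continuous_on UNIV v" "\<And>t. \<bar>v t\<bar> \<le> B"
  shows "v \<in> L2_space T"
proof (rule L2_spaceI_bounded[OF _ assms(2)])
  have "v \<in> borel_measurable borel" using assms(1) by (rule borel_measurable_continuous_onI)
  then have "v \<in> borel_measurable lborel" by simp
  then show "v \<in> borel_measurable (interval_measure T)" by (rule measurable_restrict_space1)
qed

lemma L2_inner_self_nonneg: "0 \<le> L2_inner T v v"
  unfolding L2_inner_eq by (intro integral_nonneg_AE) auto

lemma L2_norm_squared: "(L2_norm T v)\<^sup>2 = L2_inner T v v"
  by (simp add: L2_norm_def L2_inner_self_nonneg)

lemma L2_norm_nonneg: "0 \<le> L2_norm T v"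
  by (simp add: L2_norm_def L2_inner_self_nonneg)

lemma L2_inner_diff_right:
  assumes "u \<in> L2_space T" "v \<in> L2_space T" "w \<in> L2_space T"
  shows "L2_inner T u (\<lambda>t. v t - w t) = L2_inner T u v - L2_inner T u w"
  using L2_mult_integrable[OF assms(1,2)] L2_mult_integrable[OF assms(1,3)]
  by (simp add: L2_inner_eq right_diff_distrib)

lemma L2_inner_sum_right:
  assumes "u \<in> L2_space T" "\<And>k. k \<in> A \<Longrightarrow> f k \<in> L2_space T"
  shows "L2_inner T u (\<lambda>t. \<Sum>k\<in>A. c k * f k t) = (\<Sum>k\<in>A. c k * L2_inner T u (f k))"
proof -
  have "integrable (interval_measure T) (\<lambda>t. c k * (u t * f k t))" if "k \<in> A" for k
    using L2_mult_integrable[OF assms(1) assms(2)[OF that]] by simp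
  then show ?thesis
    by (simp add: L2_inner_eq sum_distrib_left mult.left_commute Bochner_Integration.integral_sum)
qed

lemma L2_inner_commute: "L2_inner T u v = L2_inner T v u"
  by (simp add: L2_inner_eq mult.commute)

text \<open>The norm square of \<open>u + t * v\<close> is a nonnegative quadratic in
  \<open>t\<close>. Its value at the minimiser \<open>t = - ?B / ?C\<close> gives the bound; if
  \<open>?C = 0\<close> the quadratic is affine, and nonnegativity forces
  \<open>?B = 0\<close>.\<close>

lemma L2_Cauchy_Schwarz:
  assumes u: "u \<in> L2_space T" and v: "v \<in> L2_space T"
  shows "\<bar>L2_inner T u v\<bar> \<le> L2_norm T u * L2_norm T v"
proof -
  let ?A = "L2_inner T u u" and ?B = "L2_inner T u v" and ?C = "L2_inner T v v"
  have quad: "0 \<le> ?A + 2 * t * ?B + t\<^sup>2 * ?C" for t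
  proof -
    have "(\<lambda>x. (u x + t * v x) * (u x + t * v x)) =
          (\<lambda>x. u x * u x + 2 * t * (u x * v x) + t\<^sup>2 * (v x * v x))"
      by (auto simp: algebra_simps power2_eq_square)
    then have "L2_inner T (\<lambda>x. u x + t * v x) (\<lambda>x. u x + t * v x) = ?A + 2 * t * ?B + t\<^sup>2 * ?C"
      using L2_mult_integrable[OF u u] L2_mult_integrable[OF u v] L2_mult_integrable[OF v v]
      by (simp add: L2_inner_eq)
    then show ?thesis by (metis L2_inner_self_nonneg)
  qed
  have C0: "0 \<le> ?C" and A0: "0 \<le> ?A" by (rule L2_inner_self_nonneg)+
  have "?B\<^sup>2 \<le> ?A * ?C"
  proof (cases "?C = 0")
    case True
    have "?B = 0"
    proof (rule ccontr)
      assume B: "?B \<noteq> 0"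
      \<comment> \<open>This \<open>t\<close> is chosen so that the affine function takes the value
        -1.\<close>
      have "0 \<le> ?A + 2 * (- (?A + 1) / (2 * ?B)) * ?B" using quad[of "- (?A + 1) / (2 * ?B)"] True by simp
      also have "\<dots> = -1" using B by (simp add: field_simps)
      finally show False by simp
    qed
    with True show ?thesis by simp
  next
    case False
    with C0 have C: "0 < ?C" by simp
    have "0 \<le> ?A + 2 * (- ?B / ?C) * ?B + (- ?B / ?C)\<^sup>2 * ?C" by (rule quad)
    also have "\<dots> = ?A - ?B\<^sup>2 / ?C" using C by (simp add: field_simps power2_eq_square)
    finally show ?thesis using C by (simp add: field_simps)
  qed
  then have "sqrt (?B\<^sup>2) \<le> sqrt (?A * ?C)" by (rule real_sqrt_le_mono)
  then show ?thesis by (simp add: L2_norm_def real_sqrt_mult)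
qed

section \<open>Completeness of the space\<close>

lemma L1_le_L2_norm:
  assumes "0 < T" "v \<in> L2_space T"
  shows "(LINT t|interval_measure T. \<bar>v t\<bar>) \<le> sqrt T * L2_norm T v"
proof -
  have one: "(\<lambda>_. 1) \<in> L2_space T" by (rule L2_spaceI_bounded[where B=1]) auto
  have abs: "(\<lambda>t. \<bar>v t\<bar>) \<in> L2_space T" using assms(2) by (auto simp: L2_space_iff)
  have "L2_inner T (\<lambda>_. 1) (\<lambda>_. 1) = T"
    using assms(1) by (simp add: L2_inner_def set_lebesgue_integral_def)
  moreover have "L2_norm T (\<lambda>t. \<bar>v t\<bar>) = L2_norm T v" by (simp add: L2_norm_def L2_inner_eq)
  ultimately show ?thesis
    using L2_Cauchy_Schwarz[OF one abs] by (auto simp: L2_norm_def L2_inner_eq)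
qed

text \<open>Riesz-Fischer argument: a fast subsequence has increments with summable L1 norms, hence
  converges almost everywhere; Fatou's lemma turns the pointwise limit into a norm limit. It is what
  guarantees that the \<open>SOME\<close> in \<open>modified_Hilbert\<close> has something to
  pick.\<close>

lemma L2_complete:
  fixes f :: "nat \<Rightarrow> real \<Rightarrow> real"
  assumes T: "0 < T" and f: "\<And>n. f n \<in> L2_space T"
    and cauchy: "\<And>e. 0 < e \<Longrightarrow> \<exists>N. \<forall>m\<ge>N. \<forall>n\<ge>N. L2_norm T (\<lambda>t. f m t - f n t) \<le> e"
  shows "\<exists>w\<in>L2_space T. (\<lambda>n. L2_norm T (\<lambda>t. w t - f n t)) \<longlonglongrightarrow> 0"
proof -
  let ?M = "interval_measure T"
  have [measurable]: "f n \<in> borel_measurable ?M" for n using f by (simp add: L2_space_iff)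
  have "\<exists>N. \<forall>k. \<forall>m\<ge>N k. \<forall>n\<ge>N k. L2_norm T (\<lambda>t. f m t - f n t) \<le> (1/2)^k"
    by (intro choice allI cauchy) simp
  then obtain N where N: "\<And>k m n. m \<ge> N k \<Longrightarrow> n \<ge> N k \<Longrightarrow> L2_norm T (\<lambda>t. f m t - f n t) \<le> (1/2)^k"
    by blast
  \<comment> \<open>Summing the thresholds makes \<open>r\<close> monotone and puts
    \<open>r j\<close> beyond every \<open>N k\<close> with \<open>k \<le> j\<close>.\<close>
  define r where "r k = (\<Sum>i\<le>k. N i)" for k :: nat
  have rN: "N k \<le> r j" if "k \<le> j" for k j
    unfolding r_def using that by (intro member_le_sum) auto
  define g where "g k t = f (r (Suc k)) t - f (r k) t" for k t
  have g: "g k \<in> L2_space T" for k unfolding g_def by (intro L2_space_diff f)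
  have [measurable]: "g k \<in> borel_measurable ?M" for k using g by (simp add: L2_space_iff)
  have one: "(\<lambda>_. 1) \<in> L2_space T" by (rule L2_spaceI_bounded[where B=1]) auto
  have g_int: "integrable ?M (\<lambda>t. \<bar>g k t\<bar>)" for k
    using L2_mult_integrable[OF one g[of k]] by auto
  have g_le: "(LINT t|?M. \<bar>g k t\<bar>) \<le> sqrt T * (1/2)^k" for k
  proof -
    have "L2_norm T (g k) \<le> (1/2)^k" unfolding g_def by (intro N rN) auto
    then show ?thesis
      using L1_le_L2_norm[OF T g[of k]] T by (meson mult_left_mono order_trans real_sqrt_ge_zero less_imp_le)
  qed
  define w where "w t = lim (\<lambda>k. f (r k) t)" for t
  have "(\<integral>\<^sup>+t. (\<Sum>k. ennreal \<bar>g k t\<bar>) \<partial>?M) = (\<Sum>k. \<integral>\<^sup>+t. ennreal \<bar>g k t\<bar> \<partial>?M)"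
    by (rule nn_integral_suminf) simp
  also have "\<dots> \<le> (\<Sum>k. ennreal (sqrt T * (1/2)^k))"
    by (intro suminf_le) (auto simp: nn_integral_eq_integral[OF g_int] intro!: ennreal_leI g_le)
  also have "\<dots> < \<infinity>"
  proof -
    have "summable (\<lambda>k. sqrt T * (1/2)^k)" by (intro summable_mult summable_geometric) simp
    then have "(\<Sum>k. ennreal (sqrt T * (1/2)^k)) = ennreal (\<Sum>k. sqrt T * (1/2)^k)"
      using T by (intro suminf_ennreal2) auto
    then show ?thesis by simp
  qed
  finally have "(\<integral>\<^sup>+t. (\<Sum>k. ennreal \<bar>g k t\<bar>) \<partial>?M) \<noteq> \<infinity>" by simp
  then have "AE t in ?M. (\<Sum>k. ennreal \<bar>g k t\<bar>) \<noteq> \<infinity>"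
    by (intro nn_integral_PInf_AE) simp_all
  then have lim: "AE t in ?M. (\<lambda>k. f (r k) t) \<longlonglongrightarrow> w t"
  proof (eventually_elim)
    case (elim t)
    then have "summable (\<lambda>k. \<bar>g k t\<bar>)"
      by (intro summable_suminf_not_top) auto
    then have "summable (\<lambda>k. g k t)" by (rule summable_rabs_cancel)
    then have "(\<lambda>n. \<Sum>k<n. g k t) \<longlonglongrightarrow> (\<Sum>k. g k t)" by (rule summable_LIMSEQ)
    then have "(\<lambda>n. (\<Sum>k<n. g k t) + f (r 0) t) \<longlonglongrightarrow> (\<Sum>k. g k t) + f (r 0) t"
      by (intro tendsto_intros)
    moreover have "(\<Sum>k<n. g k t) + f (r 0) t = f (r n) t" for n
      using sum_lessThan_telescope[of "\<lambda>k. f (r k) t" n] by (simp add: g_def)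
    ultimately have "convergent (\<lambda>k. f (r k) t)" by (auto simp: convergent_def)
    then show ?case by (simp add: w_def convergent_LIMSEQ_iff)
  qed
  have [measurable]: "w \<in> borel_measurable ?M" unfolding w_def by measurable
  \<comment> \<open>For fixed \<open>n\<close>, the distance from \<open>f n\<close> to
    \<open>w\<close> is the limit in \<open>j\<close> of the distances from \<open>f n\<close> to
    \<open>f (r j)\<close>, all at most \<open>(1/2)^k\<close> in norm once
    \<open>k \<le> j\<close>.\<close>
  have fatou: "(\<integral>\<^sup>+t. ennreal ((w t - f n t)\<^sup>2) \<partial>?M) \<le> ennreal (((1/2)^k)\<^sup>2)" if n: "n \<ge> N k" for n k
  proof -
    have "(\<integral>\<^sup>+t. ennreal ((w t - f n t)\<^sup>2) \<partial>?M) = (\<integral>\<^sup>+t. liminf (\<lambda>j. ennreal ((f (r j) t - f n t)\<^sup>2)) \<partial>?M)"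
    proof (rule nn_integral_cong_AE, use lim in eventually_elim)
      case (elim t)
      then have "(\<lambda>j. ennreal ((f (r j) t - f n t)\<^sup>2)) \<longlonglongrightarrow> ennreal ((w t - f n t)\<^sup>2)"
        by (intro tendsto_intros)
      then show ?case by (rule lim_imp_Liminf[OF sequentially_bot, symmetric])
    qed
    also have "\<dots> \<le> liminf (\<lambda>j. \<integral>\<^sup>+t. ennreal ((f (r j) t - f n t)\<^sup>2) \<partial>?M)"
      by (rule nn_integral_liminf) simp
    also have "\<dots> \<le> limsup (\<lambda>j. \<integral>\<^sup>+t. ennreal ((f (r j) t - f n t)\<^sup>2) \<partial>?M)"
      by (rule Liminf_le_Limsup) simp
    also have "\<dots> \<le> ennreal (((1/2)^k)\<^sup>2)"
    proof (rule Limsup_bounded, use eventually_ge_at_top[of k] in eventually_elim)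
      case (elim j)
      have d: "(\<lambda>t. f (r j) t - f n t) \<in> L2_space T" by (intro L2_space_diff f)
      have "(\<integral>\<^sup>+t. ennreal ((f (r j) t - f n t)\<^sup>2) \<partial>?M) = ennreal ((L2_norm T (\<lambda>t. f (r j) t - f n t))\<^sup>2)"
        unfolding L2_norm_squared L2_inner_eq using d
        by (subst nn_integral_eq_integral) (auto simp: L2_space_iff power2_eq_square)
      also have "\<dots> \<le> ennreal (((1/2)^k)\<^sup>2)"
        by (intro ennreal_leI power_mono L2_norm_nonneg N rN n elim)
      finally show ?case .
    qed
    finally show ?thesis .
  qed
  have diff: "(\<lambda>t. w t - f n t) \<in> L2_space T \<and> L2_norm T (\<lambda>t. w t - f n t) \<le> (1/2)^k"
    if n: "n \<ge> N k" for n k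
  proof
    have "integrable ?M (\<lambda>t. (w t - f n t)\<^sup>2)"
      by (rule integrableI_nonneg) (use fatou[OF n] in \<open>auto simp: order_le_less_trans\<close>)
    then show d: "(\<lambda>t. w t - f n t) \<in> L2_space T" by (auto simp: L2_space_iff)
    have "ennreal ((L2_norm T (\<lambda>t. w t - f n t))\<^sup>2) = (\<integral>\<^sup>+t. ennreal ((w t - f n t)\<^sup>2) \<partial>?M)"
      unfolding L2_norm_squared L2_inner_eq using d
      by (subst nn_integral_eq_integral) (auto simp: L2_space_iff power2_eq_square)
    also have "\<dots> \<le> ennreal (((1/2)^k)\<^sup>2)" by (rule fatou[OF n])
    finally have "(L2_norm T (\<lambda>t. w t - f n t))\<^sup>2 \<le> ((1/2)^k)\<^sup>2" by (simp add: ennreal_le_iff)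
    then show "L2_norm T (\<lambda>t. w t - f n t) \<le> (1/2)^k" by (rule power2_le_imp_le) simp
  qed
  show ?thesis
  proof
    show "w \<in> L2_space T"
      using L2_space_add[OF conjunct1[OF diff[OF order_refl, of 0]] f[of "N 0"]] by simp
    show "(\<lambda>n. L2_norm T (\<lambda>t. w t - f n t)) \<longlonglongrightarrow> 0"
    proof (rule LIMSEQ_I)
      fix e :: real assume "0 < e"
      then obtain k where k: "(1/2)^k < e" using real_arch_pow_inv[of e "1/2"] by auto
      show "\<exists>n0. \<forall>n\<ge>n0. norm (L2_norm T (\<lambda>t. w t - f n t) - 0) < e"
        using k diff[of k] L2_norm_nonneg by (intro exI[of _ "N k"]) (force simp: abs_of_nonneg)
    qed
  qed
qed

subsection \<open>Discrete cosine and sine transforms\<close>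

text \<open>Each cosine times \<open>2 * sin a\<close> is a difference of sines at neighbouring even
  multiples of \<open>a\<close>, so the sum telescopes. Keeping the factor on the left avoids a case
  distinction on \<open>sin a = 0\<close>.\<close>

lemma sum_cos_odd_multiples:
  "(\<Sum>k<n. cos ((2 * real k + 1) * a)) * (2 * sin a) = sin (2 * real n * a)"
proof (induction n)
  case (Suc n)
  have "cos ((2 * real n + 1) * a) * (2 * sin a) = sin (2 * real (Suc n) * a) - sin (2 * real n * a)"
  proof -
    have e: "2 * real (Suc n) * a = (2 * real n + 1) * a + a" "2 * real n * a = (2 * real n + 1) * a - a"
      by (auto simp: algebra_simps)
    show ?thesis unfolding e sin_add sin_diff by simp
  qed
  with Suc show ?case by (simp add: distrib_right)
qed simp

text \<open>The telescoped value is the sine of \<open>m * pi\<close>, hence 0, while the bound on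
  \<open>m\<close> keeps the divisor \<open>sin ?a\<close> away from 0 unless
  \<open>m = 0\<close>.\<close>

lemma sum_cos_grid:
  fixes m :: int
  assumes "n \<ge> 1" "\<bar>m\<bar> < 2 * int n"
  shows "(\<Sum>k<n. cos ((2 * real k + 1) * (pi * real_of_int m / (2 * real n)))) = (if m = 0 then real n else 0)"
proof (cases "m = 0")
  case False
  let ?a = "pi * real_of_int m / (2 * real n)"
  have "sin (2 * real n * ?a) = sin (real_of_int m * pi)" using assms by (simp add: mult.commute)
  also have "\<dots> = 0" using sin_times_pi_eq_0 by simp
  finally have 1: "(\<Sum>k<n. cos ((2 * real k + 1) * ?a)) * (2 * sin ?a) = 0"
    using sum_cos_odd_multiples[of ?a n] by simp
  have "sin ?a \<noteq> 0"
  proof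
    assume "sin ?a = 0"
    then have "sin ((real_of_int m / (2 * real n)) * pi) = 0" by (simp add: mult.commute)
    then obtain j where "real_of_int m / (2 * real n) = real_of_int j"
      unfolding sin_times_pi_eq_0 by (auto elim: Ints_cases)
    then have "real_of_int m = real_of_int (j * (2 * int n))" using assms by (simp add: field_simps)
    then have "m = j * (2 * int n)" by linarith
    with assms False have "\<bar>j\<bar> * (2 * int n) < 1 * (2 * int n)" "j \<noteq> 0" by (auto simp: abs_mult)
    then show False using assms by (simp add: mult_less_cancel_right)
  qed
  with 1 False show ?thesis by simp
qed simp

text \<open>Phase of mode \<open>k\<close> at the midpoint \<open>(2i + 1) T / (2n)\<close> of
  element \<open>i\<close>; \<open>T\<close> cancels, and the expression is symmetric in
  \<open>k\<close> and \<open>i\<close>.\<close>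

definition grid_angle :: "nat \<Rightarrow> nat \<Rightarrow> nat \<Rightarrow> real" where
  "grid_angle n k i = pi * (2 * real k + 1) * (2 * real i + 1) / (4 * real n)"

lemma grid_angle_commute: "grid_angle n k i = grid_angle n i k"
  by (simp add: grid_angle_def mult_ac)

text \<open>Both are instances of \<open>sum_cos_grid\<close>, with \<open>m = i - j\<close> and
  \<open>m = i + j + 1\<close>; the latter lies strictly between 0 and \<open>2n\<close>.\<close>

lemma grid_angle_sums:
  assumes "n \<ge> 1" "i < n" "j < n"
  shows "(\<Sum>k<n. cos (grid_angle n k i - grid_angle n k j)) = (if i = j then real n else 0)"
    and "(\<Sum>k<n. cos (grid_angle n k i + grid_angle n k j)) = 0"
proof -
  have d: "grid_angle n k i - grid_angle n k j =
      (2 * real k + 1) * (pi * real_of_int (int i - int j) / (2 * real n))" for k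
    using assms by (simp add: grid_angle_def field_simps)
  have s: "grid_angle n k i + grid_angle n k j =
      (2 * real k + 1) * (pi * real_of_int (int i + int j + 1) / (2 * real n))" for k
    using assms by (simp add: grid_angle_def field_simps)
  show "(\<Sum>k<n. cos (grid_angle n k i - grid_angle n k j)) = (if i = j then real n else 0)"
    unfolding d by (subst sum_cos_grid) (use assms in auto)
  show "(\<Sum>k<n. cos (grid_angle n k i + grid_angle n k j)) = 0"
    unfolding s by (subst sum_cos_grid) (use assms in auto)
qed

lemma grid_cos_orthogonal:
  assumes "n \<ge> 1" "i < n" "j < n"
  shows "(\<Sum>k<n. cos (grid_angle n k i) * cos (grid_angle n k j)) = (if i = j then real n / 2 else 0)"
  unfolding cos_times_cos using grid_angle_sums[OF assms]
  by (simp add: sum.distrib flip: sum_divide_distrib)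

lemma grid_sin_orthogonal:
  assumes "n \<ge> 1" "i < n" "j < n"
  shows "(\<Sum>k<n. sin (grid_angle n k i) * sin (grid_angle n k j)) = (if i = j then real n / 2 else 0)"
  unfolding sin_times_sin using grid_angle_sums[OF assms]
  by (simp add: sum_subtractf flip: sum_divide_distrib)

text \<open>In matrix form: if the columns of \<open>Q\<close> are orthogonal with common norm
  square \<open>c\<close>, then \<open>Q\<close> multiplies norm squares by
  \<open>c\<close>.\<close>

lemma grid_Parseval:
  fixes Q :: "nat \<Rightarrow> nat \<Rightarrow> real"
  assumes "\<And>i j. i < n \<Longrightarrow> j < n \<Longrightarrow> (\<Sum>k<n. Q k i * Q k j) = (if i = j then c else 0)"
  shows "(\<Sum>k<n. (\<Sum>i<n. a i * Q k i)\<^sup>2) = c * (\<Sum>i<n. (a i)\<^sup>2)"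
proof -
  have "(\<Sum>k<n. (\<Sum>i<n. a i * Q k i)\<^sup>2) = (\<Sum>k<n. \<Sum>i<n. \<Sum>j<n. a i * a j * (Q k i * Q k j))"
    by (simp add: power2_eq_square sum_product mult_ac)
  also have "\<dots> = (\<Sum>i<n. \<Sum>k<n. \<Sum>j<n. a i * a j * (Q k i * Q k j))" by (rule sum.swap)
  also have "\<dots> = (\<Sum>i<n. \<Sum>j<n. a i * a j * (\<Sum>k<n. Q k i * Q k j))"
    by (rule sum.cong[OF refl], subst sum.swap) (simp add: sum_distrib_left)
  also have "\<dots> = (\<Sum>i<n. \<Sum>j<n. if i = j then c * (a i)\<^sup>2 else 0)"
    by (intro sum.cong refl) (auto simp: assms power2_eq_square)
  also have "\<dots> = c * (\<Sum>i<n. (a i)\<^sup>2)" by (simp add: sum_distrib_left)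
  finally show ?thesis .
qed

text \<open>The sine matrix is symmetric and its square is \<open>n / 2\<close> times the identity,
  so \<open>2 / n\<close> times the matrix inverts it. Cosine and sine matrices scale norm squares
  by the same \<open>n / 2\<close>, whence the equality of norms.\<close>

lemma grid_cos_sin_transfer:
  fixes a :: "nat \<Rightarrow> real"
  assumes n: "n \<ge> 1"
  obtains b where
    "\<And>k. k < n \<Longrightarrow> (\<Sum>i<n. b i * sin (grid_angle n k i)) = (\<Sum>i<n. a i * cos (grid_angle n k i))"
    "(\<Sum>i<n. (b i)\<^sup>2) = (\<Sum>i<n. (a i)\<^sup>2)"
proof -
  define c where "c k = (\<Sum>i<n. a i * cos (grid_angle n k i))" for k
  define b where "b i = 2 / real n * (\<Sum>k<n. c k * sin (grid_angle n i k))" for i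
  have 1: "(\<Sum>i<n. b i * sin (grid_angle n k i)) = c k" if k: "k < n" for k
  proof -
    have "(\<Sum>i<n. b i * sin (grid_angle n k i)) =
        2 / real n * (\<Sum>i<n. \<Sum>l<n. c l * (sin (grid_angle n i l) * sin (grid_angle n i k)))"
      by (simp add: b_def sum_distrib_left sum_distrib_right mult.assoc grid_angle_commute[of n k])
    also have "\<dots> = 2 / real n * (\<Sum>l<n. c l * (\<Sum>i<n. sin (grid_angle n i l) * sin (grid_angle n i k)))"
      by (subst sum.swap) (simp add: sum_distrib_left)
    also have "\<dots> = 2 / real n * (\<Sum>l<n. if l = k then c l * (real n / 2) else 0)"
      using k n by (intro arg_cong2[where f="(*)"] sum.cong refl) (auto simp: grid_sin_orthogonal)
    also have "\<dots> = c k" using k n by simp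
    finally show ?thesis .
  qed
  have P: "(\<Sum>k<n. (\<Sum>i<n. b i * sin (grid_angle n k i))\<^sup>2) = real n / 2 * (\<Sum>i<n. (b i)\<^sup>2)"
    by (rule grid_Parseval[where Q="\<lambda>k i. sin (grid_angle n k i)"]) (use n grid_sin_orthogonal in auto)
  have Q: "(\<Sum>k<n. (c k)\<^sup>2) = real n / 2 * (\<Sum>i<n. (a i)\<^sup>2)"
    unfolding c_def
    by (rule grid_Parseval[where Q="\<lambda>k i. cos (grid_angle n k i)"]) (use n grid_cos_orthogonal in auto)
  show thesis
  proof (rule that)
    show "(\<Sum>i<n. b i * sin (grid_angle n k i)) = (\<Sum>i<n. a i * cos (grid_angle n k i))" if "k < n" for k
      using 1[OF that] by (simp add: c_def)
    show "(\<Sum>i<n. (b i)\<^sup>2) = (\<Sum>i<n. (a i)\<^sup>2)" using P Q 1 n by simp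
  qed
qed

text \<open>Aliasing: modulo sign, the grid only sees the mode \<open>k\<close> up to the reflection
  \<open>k \<mapsto> 2n - 1 - k\<close> and shifts by \<open>2n\<close>.\<close>

lemma grid_angle_shift:
  assumes "n \<ge> 1"
  shows "grid_angle n (2 * n * l + k) i = grid_angle n k i + real (l * (2 * i + 1)) * pi"
  using assms by (simp add: grid_angle_def field_simps)

lemma grid_angle_reflect:
  assumes "n \<ge> 1" "k < n"
  shows "grid_angle n (2 * n * l + (2 * n - 1 - k)) i =
     real (Suc l * (2 * i + 1)) * pi - grid_angle n k i"
proof -
  have "real (2 * n * l + (2 * n - 1 - k)) = 2 * real n * real l + (2 * real n - 1 - real k)"
    using assms by (simp add: of_nat_diff)
  then show ?thesis unfolding grid_angle_def using assms(1) by (simp only:) (simp add: field_simps)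
qed

lemma cos_sin_add_npi:
  "cos (x + real m * pi) = (-1) ^ m * cos x" "sin (x + real m * pi) = (-1) ^ m * sin x"
  "cos (real m * pi - x) = (-1) ^ m * cos x" "sin (real m * pi - x) = - ((-1) ^ m * sin x)"
  by (simp_all add: cos_add sin_add cos_diff sin_diff)

lemma minus_one_power_odd_multiple: "(-1::real) ^ (m * (2 * i + 1)) = (-1) ^ m"
  by (subst mult.commute, subst power_mult) simp

text \<open>The added multiple of \<open>pi\<close> has the odd factor \<open>2 * i + 1\<close>, so
  the sign does not depend on \<open>i\<close>. Only the reflected cosine carries an extra minus
  sign, and this is why paired modes enter the bilinear form with opposite signs.\<close>

lemma grid_aliasing:
  assumes n: "n \<ge> 1" and k: "k < n"
  shows "cos (grid_angle n (2 * n * l + k) i) = (-1) ^ l * cos (grid_angle n k i)"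
    and "sin (grid_angle n (2 * n * l + k) i) = (-1) ^ l * sin (grid_angle n k i)"
    and "cos (grid_angle n (2 * n * l + (2 * n - 1 - k)) i) = - ((-1) ^ l * cos (grid_angle n k i))"
    and "sin (grid_angle n (2 * n * l + (2 * n - 1 - k)) i) = (-1) ^ l * sin (grid_angle n k i)"
  unfolding grid_angle_reflect[OF n k] unfolding grid_angle_shift[OF n] cos_sin_add_npi minus_one_power_odd_multiple
  by simp_all

section \<open>Elementary inequalities and the limit of the constants\<close>

text \<open>Jordan's inequality: by concavity the sine lies above its chord from 0 to
  \<open>pi / 2\<close>. The convexity inequality is used with weight
  \<open>2 / pi * x\<close>.\<close>

lemma sin_ge_two_over_pi:
  fixes x :: real
  assumes "0 \<le> x" "x \<le> pi / 2"
  shows "2 / pi * x \<le> sin x"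
proof -
  have "convex_on {0..pi/2} (\<lambda>x. - sin x)"
    by (rule convex_on_realI[where f'="\<lambda>x. - cos x"])
      (auto intro!: derivative_eq_intros cos_monotone_0_pi_le)
  from convex_onD[OF this, of "2 / pi * x" 0 "pi/2"] assms
  show ?thesis by (simp add: field_simps)
qed

text \<open>The numerator is \<open>(N - x)\<close> squared minus \<open>x\<close> squared. With
  \<open>N = 4n\<close> and \<open>x = 2M + 1\<close> this rewrites the fraction in
  \<open>c_S\<close>.\<close>

lemma diff_square_quotient:
  fixes N x :: real
  assumes "x < N"
  shows "(N\<^sup>2 - 2 * N * x) / (N - x)\<^sup>2 = 1 - (x / (N - x))\<^sup>2"
proof -
  have "(N - x)\<^sup>2 \<noteq> 0" using assms by simp
  then show ?thesis by (simp add: field_simps power2_eq_square)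
qed

lemma c_S_limit_approx: "\<bar>2 * sqrt 3 / pi\<^sup>2 - 0.351\<bar> < (0.0005::real)"
proof -
  have p: "3.1415\<^sup>2 \<le> pi\<^sup>2" "pi\<^sup>2 \<le> 3.1416\<^sup>2" using pi_approx by (auto intro!: power_mono)
  have s: "1.732 \<le> sqrt 3" "sqrt 3 \<le> 1.7321"
    by (rule real_le_rsqrt real_le_lsqrt; simp add: power2_eq_square)+
  have "2 * sqrt 3 / pi\<^sup>2 < 0.3515" using p s by (simp add: field_simps power2_eq_square)
  moreover have "2 * sqrt 3 / pi\<^sup>2 > 0.3505" using p s by (simp add: field_simps power2_eq_square)
  moreover have "y < 0.3515 \<Longrightarrow> y > 0.3505 \<Longrightarrow> \<bar>y - 0.351\<bar> < 0.0005" for y :: real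
    by (simp add: abs_if)
  ultimately show ?thesis by blast
qed

lemma c_S_limit: "(\<lambda>n. 1 / 2 * (2 * sqrt 3 / pi\<^sup>2) * (8 / (2 + 1 / real n)\<^sup>2)) \<longlonglongrightarrow> 2 * sqrt 3 / pi\<^sup>2"
proof -
  have "(\<lambda>n. 1 / 2 * (2 * sqrt 3 / pi\<^sup>2) * (8 / (2 + 1 / real n)\<^sup>2)) \<longlonglongrightarrow>
      1 / 2 * (2 * sqrt 3 / pi\<^sup>2) * (8 / (2 + 0)\<^sup>2)"
    by (intro tendsto_intros lim_1_over_n) auto
  then show ?thesis by (simp add: mult.commute)
qed

subsection \<open>The modified Hilbert transformation\<close>

lemma interval_integral_cos:
  fixes c :: real
  assumes "c \<noteq> 0"
  shows "(LBINT t=a..b. cos (c * t)) = (sin (c * b) - sin (c * a)) / c"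
proof -
  have "(LBINT t=a..b. cos (c * t)) = sin (c * b) / c - sin (c * a) / c"
    by (rule interval_integral_FTC_finite)
      (use assms in \<open>auto intro!: continuous_intros derivative_eq_intros
         simp flip: has_real_derivative_iff_has_vector_derivative\<close>)
  then show ?thesis by (simp add: diff_divide_distrib)
qed

lemma interval_integral_sin:
  fixes c :: real
  assumes "c \<noteq> 0"
  shows "(LBINT t=a..b. sin (c * t)) = (cos (c * a) - cos (c * b)) / c"
proof -
  have "(LBINT t=a..b. sin (c * t)) = - (cos (c * b) / c) - (- (cos (c * a) / c))"
    by (rule interval_integral_FTC_finite)
      (use assms in \<open>auto intro!: continuous_intros derivative_eq_intros
         simp flip: has_real_derivative_iff_has_vector_derivative\<close>)
  then show ?thesis by (simp add: diff_divide_distrib)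
qed

abbreviation cos_mode :: "real \<Rightarrow> nat \<Rightarrow> real \<Rightarrow> real" where
  "cos_mode T k \<equiv> \<lambda>t. cos (freq T k * t)"

lemma cos_mode_L2: "cos_mode T k \<in> L2_space T"
  by (rule L2_space_continuous_bounded[where B=1]) (auto intro!: continuous_intros)

lemma L2_inner_interval: "0 \<le> T \<Longrightarrow> L2_inner T u v = (LBINT t=0..T. u t * v t)"
  by (simp add: L2_inner_def interval_lebesgue_integral_le_eq zero_ereal_def)

lemma interval_integral_cos_npi:
  fixes m :: int
  assumes "0 < T"
  shows "(LBINT t=0..T. cos (real_of_int m * pi / T * t)) = (if m = 0 then T else 0)"
proof (cases "m = 0")
  case True
  then show ?thesis using assms by (simp add: zero_ereal_def)
next
  case False
  then have "real_of_int m * pi / T \<noteq> 0" using assms by simp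
  from interval_integral_cos[OF this, of 0 T] show ?thesis
    using False assms sin_times_pi_eq_0[of "real_of_int m"] by (simp add: zero_ereal_def)
qed

text \<open>Product-to-sum formulas leave cosines of integer multiples of \<open>pi / T\<close>,
  namely \<open>j - k\<close> and \<open>j + k + 1\<close>; the second integer is never 0, so only
  \<open>j = k\<close> contributes.\<close>

lemma cos_mode_orthogonal:
  assumes T: "0 < T"
  shows "L2_inner T (cos_mode T j) (cos_mode T k) = (if j = k then T / 2 else 0)"
proof -
  have e: "freq T j * t - freq T k * t = real_of_int (int j - int k) * pi / T * t"
    "freq T j * t + freq T k * t = real_of_int (int j + int k + 1) * pi / T * t" for t
    using T by (auto simp: freq_def field_simps)
  have i: "interval_lebesgue_integrable lborel 0 T (\<lambda>t. cos (c * t))" for c :: real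
    unfolding zero_ereal_def
    by (rule interval_integrable_continuous_on) (use T in \<open>auto intro!: continuous_intros\<close>)
  have "L2_inner T (cos_mode T j) (cos_mode T k) =
      (LBINT t=0..T. cos (real_of_int (int j - int k) * pi / T * t) / 2
         + cos (real_of_int (int j + int k + 1) * pi / T * t) / 2)"
    using T by (simp add: L2_inner_interval cos_times_cos e add_divide_distrib)
  also have "\<dots> = (LBINT t=0..T. cos (real_of_int (int j - int k) * pi / T * t)) / 2 +
      (LBINT t=0..T. cos (real_of_int (int j + int k + 1) * pi / T * t)) / 2"
    using i by (subst interval_lebesgue_integral_add)
      (simp_all only: interval_lebesgue_integrable_divide interval_lebesgue_integral_divide)
  also have "\<dots> = (if j = k then T / 2 else 0)"
    unfolding interval_integral_cos_npi[OF T] by auto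
  finally show ?thesis .
qed

lemma L2_norm_cos_sum:
  assumes T: "0 < T" and "finite A"
  shows "(L2_norm T (\<lambda>t. \<Sum>k\<in>A. c k * cos_mode T k t))\<^sup>2 = T / 2 * (\<Sum>k\<in>A. (c k)\<^sup>2)"
proof -
  let ?s = "\<lambda>t. \<Sum>k\<in>A. c k * cos_mode T k t"
  have s: "?s \<in> L2_space T" by (intro L2_space_sum L2_space_scale cos_mode_L2)
  have 1: "L2_inner T ?s (cos_mode T j) = c j * (T / 2)" if "j \<in> A" for j
    unfolding L2_inner_commute[of T ?s]
    using that assms by (simp add: L2_inner_sum_right cos_mode_L2 cos_mode_orthogonal if_distrib cong: if_cong)
  have "(L2_norm T ?s)\<^sup>2 = (\<Sum>k\<in>A. c k * L2_inner T ?s (cos_mode T k))"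
    unfolding L2_norm_squared by (rule L2_inner_sum_right[OF s]) (rule cos_mode_L2)
  also have "\<dots> = (\<Sum>k\<in>A. c k * (c k * (T / 2)))" by (intro sum.cong refl) (simp only: 1)
  also have "\<dots> = T / 2 * (\<Sum>k\<in>A. (c k)\<^sup>2)"
    by (simp add: sum_distrib_left power2_eq_square mult_ac)
  finally show ?thesis .
qed

text \<open>By orthogonality the partial sums of the cosine series are Cauchy as soon as the
  coefficients are square summable; completeness then provides a limit, and \<open>SOME\<close>
  picks one.\<close>

lemma modified_Hilbert_converges:
  assumes T: "0 < T" and sq: "summable (\<lambda>k. (sin_coeff_T T v k)\<^sup>2)"
  shows "modified_Hilbert T v \<in> L2_space T"
    and "(\<lambda>N. L2_norm T (\<lambda>t. modified_Hilbert T v t -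
           (\<Sum>k<N. sin_coeff_T T v k * cos_mode T k t))) \<longlonglongrightarrow> 0"
proof -
  let ?c = "sin_coeff_T T v"
  define S where "S N t = (\<Sum>k<N. ?c k * cos_mode T k t)" for N t
  have S: "S N \<in> L2_space T" for N
    unfolding S_def by (intro L2_space_sum L2_space_scale cos_mode_L2)
  have sym: "L2_norm T (\<lambda>t. S m t - S n t) = L2_norm T (\<lambda>t. S n t - S m t)" for m n
    by (simp add: L2_norm_def L2_inner_def algebra_simps)
  have diff: "(L2_norm T (\<lambda>t. S n t - S m t))\<^sup>2 = T / 2 * (\<Sum>k=m..<n. (?c k)\<^sup>2)" if "m \<le> n" for m n
  proof -
    have "S n t - S m t = (\<Sum>k=m..<n. ?c k * cos_mode T k t)" for t
      using that by (simp add: S_def lessThan_atLeast0 sum_diff_nat_ivl)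
    then show ?thesis using L2_norm_cos_sum[OF T, of "{m..<n}" ?c] by simp
  qed
  have "\<exists>N. \<forall>m\<ge>N. \<forall>n\<ge>N. L2_norm T (\<lambda>t. S m t - S n t) \<le> e" if "0 < e" for e
  proof -
    \<comment> \<open>The factor \<open>2 / T\<close> cancels the norm square \<open>T / 2\<close>
      of the modes.\<close>
    have "0 < 2 / T * e\<^sup>2" using T that by simp
    then obtain N where N: "\<And>m n. m \<ge> N \<Longrightarrow> norm (\<Sum>k=m..<n. (?c k)\<^sup>2) < 2 / T * e\<^sup>2"
      using sq unfolding summable_Cauchy by blast
    have le: "L2_norm T (\<lambda>t. S n t - S m t) \<le> e" if "N \<le> m" "m \<le> n" for m n
    proof (rule power2_le_imp_le)
      have "(\<Sum>k=m..<n. (?c k)\<^sup>2) \<le> 2 / T * e\<^sup>2" using N[OF that(1), of n] by simp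
      then show "(L2_norm T (\<lambda>t. S n t - S m t))\<^sup>2 \<le> e\<^sup>2"
        unfolding diff[OF that(2)] using T by (simp add: field_simps)
    qed (use \<open>0 < e\<close> in simp)
    show ?thesis
    proof (intro exI[of _ N] allI impI)
      fix m n assume "N \<le> m" "N \<le> n"
      then show "L2_norm T (\<lambda>t. S m t - S n t) \<le> e"
        using le[of m n] le[of n m] sym[of m n] by (cases "m \<le> n") auto
    qed
  qed
  from L2_complete[OF T S this]
  have "\<exists>w. w \<in> L2_space T \<and> (\<lambda>N. L2_norm T (\<lambda>t. w t - (\<Sum>k<N. ?c k * cos_mode T k t))) \<longlonglongrightarrow> 0"
    unfolding S_def by blast
  from someI_ex[OF this] show "modified_Hilbert T v \<in> L2_space T"
    and "(\<lambda>N. L2_norm T (\<lambda>t. modified_Hilbert T v t - (\<Sum>k<N. ?c k * cos_mode T k t))) \<longlonglongrightarrow> 0"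
    unfolding modified_Hilbert_def by blast+
qed

text \<open>Cauchy-Schwarz makes the inner product with \<open>u\<close> continuous, so the series
  may be paired with \<open>u\<close> term by term. The result depends on the chosen representative
  only through its class.\<close>

lemma modified_Hilbert_inner:
  assumes T: "0 < T" and u: "u \<in> L2_space T" and sq: "summable (\<lambda>k. (sin_coeff_T T v k)\<^sup>2)"
  shows "(\<lambda>N. T / 2 * (\<Sum>k<N. cos_coeff_T T u k * sin_coeff_T T v k))
           \<longlonglongrightarrow> L2_inner T u (modified_Hilbert T v)"
proof -
  let ?H = "modified_Hilbert T v" and ?c = "sin_coeff_T T v"
  let ?S = "\<lambda>N t. \<Sum>k<N. ?c k * cos_mode T k t"
  note H = modified_Hilbert_converges[OF T sq]
  have S: "?S N \<in> L2_space T" for N by (intro L2_space_sum L2_space_scale cos_mode_L2)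
  have mode: "L2_inner T u (cos_mode T k) = T / 2 * cos_coeff_T T u k" for k
    using T by (simp add: cos_coeff_T_def L2_inner_def)
  have eq: "L2_inner T u (?S N) = T / 2 * (\<Sum>k<N. cos_coeff_T T u k * ?c k)" for N
    unfolding L2_inner_sum_right[OF u cos_mode_L2] mode by (simp add: sum_distrib_left mult_ac)
  have "(\<lambda>N. L2_inner T u ?H - L2_inner T u (?S N)) \<longlonglongrightarrow> 0"
  proof (rule Lim_null_comparison)
    show "\<forall>\<^sub>F N in sequentially. norm (L2_inner T u ?H - L2_inner T u (?S N))
        \<le> L2_norm T u * L2_norm T (\<lambda>t. ?H t - ?S N t)"
      using L2_Cauchy_Schwarz[OF u L2_space_diff[OF H(1) S]]
      by (simp add: L2_inner_diff_right[OF u H(1) S])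
    show "(\<lambda>N. L2_norm T u * L2_norm T (\<lambda>t. ?H t - ?S N t)) \<longlonglongrightarrow> 0"
      using tendsto_mult_left[OF H(2), of "L2_norm T u"] by simp
  qed
  then have "(\<lambda>N. L2_inner T u ?H - (L2_inner T u ?H - L2_inner T u (?S N))) \<longlonglongrightarrow> L2_inner T u ?H - 0"
    by (intro tendsto_intros)
  then show ?thesis by (simp add: eq)
qed

subsection \<open>Step functions\<close>

text \<open>Elements are numbered from 0 here, to match sums over \<open>i<n\<close>. Values at the
  nodes are left free, since the nodes form a null set.\<close>

definition has_step_values :: "real \<Rightarrow> nat \<Rightarrow> (real \<Rightarrow> real) \<Rightarrow> (nat \<Rightarrow> real) \<Rightarrow> bool" where
  "has_step_values T n u a \<longleftrightarrow> u \<in> L2_space T \<and>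
     (\<forall>i<n. \<forall>t\<in>{real i * (T / real n)<..<real (Suc i) * (T / real n)}. u t = a i)"

lemma step_space_iff: "u \<in> step_space T n \<longleftrightarrow> (\<exists>a. has_step_values T n u a)"
proof
  assume u: "u \<in> step_space T n"
  then have c: "\<forall>i\<in>{1..n}. u constant_on {real (i - 1) * (T / real n)<..<real i * (T / real n)}"
    by (simp add: step_space_def)
  have "\<exists>c. \<forall>t\<in>{real i * (T / real n)<..<real (Suc i) * (T / real n)}. u t = c" if "i < n" for i
    using bspec[OF c, of "Suc i"] that by (simp add: constant_on_def del: of_nat_Suc)
  then show "\<exists>a. has_step_values T n u a"
    using u unfolding has_step_values_def step_space_def by (auto intro!: choice)
next
  assume "\<exists>a. has_step_values T n u a"
  then obtain a where a: "has_step_values T n u a" ..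
  have "u constant_on {real (i - 1) * (T / real n)<..<real i * (T / real n)}" if "i \<in> {1..n}" for i
  proof -
    obtain j where "i = Suc j" "j < n" using \<open>i \<in> {1..n}\<close> by (cases i) auto
    with a show ?thesis unfolding has_step_values_def constant_on_def by auto
  qed
  with a show "u \<in> step_space T n" by (simp add: step_space_def has_step_values_def)
qed

lemma ex_step_values:
  assumes "0 < T"
  shows "\<exists>u. has_step_values T n u a"
proof (intro exI)
  define h where "h = T / real n"
  let ?I = "\<lambda>i. {real i * h<..<real (Suc i) * h}"
  let ?u = "\<lambda>t. \<Sum>i<n. a i * indicator (?I i) t"
  have "\<bar>?u t\<bar> \<le> (\<Sum>i<n. \<bar>a i\<bar>)" for t
    by (rule order_trans[OF sum_abs sum_mono]) (simp add: indicator_def)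
  moreover have "?u \<in> borel_measurable (interval_measure T)"
    by (intro measurable_restrict_space1) measurable
  ultimately have "?u \<in> L2_space T" by (intro L2_spaceI_bounded)
  moreover have "?u t = a i" if i: "i < n" and t: "t \<in> ?I i" for i t
  proof -
    have "0 < h" using assms i by (simp add: h_def)
    have "j = i" if "t \<in> ?I j" for j
    proof -
      have "real j * h < real (Suc i) * h" "real i * h < real (Suc j) * h" using that t by auto
      then have "j < Suc i" "i < Suc j" using \<open>0 < h\<close> by (simp_all only: mult_less_cancel_right_pos of_nat_less_iff)
      then show ?thesis by simp
    qed
    then have "indicator (?I j) t = (if j = i then 1 else 0 :: real)" for j
      using t unfolding indicator_def by (smt (verit) of_bool_eq)
    then have "?u t = (\<Sum>j<n. if j = i then a i else 0)"
      by (intro sum.cong) simp_all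
    then show ?thesis using i by simp
  qed
  ultimately show "has_step_values T n ?u a" by (simp add: has_step_values_def h_def)
qed

text \<open>Induction on the number \<open>m\<close> of leading elements covered; each step splits
  off one element, on which \<open>u\<close> is the constant \<open>a m\<close>.\<close>

lemma L2_inner_step:
  assumes T: "0 < T" and n: "n \<ge> 1" and u: "has_step_values T n u a" and f: "f \<in> L2_space T"
  shows "L2_inner T u f =
    (\<Sum>i<n. a i * (LBINT t=real i * (T / real n)..real (Suc i) * (T / real n). f t))"
proof -
  define h where "h = T / real n"
  have h: "0 < h" "real n * h = T" using T n by (auto simp: h_def)
  have "integrable (interval_measure T) (\<lambda>t. u t * f t)"
    using u f by (intro L2_mult_integrable) (auto simp: has_step_values_def)
  then have int: "set_integrable lborel {0<..<T} (\<lambda>t. u t * f t)"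
    by (simp add: set_integrable_def integrable_restrict_space)
  have "(LBINT t=0..real m * h. u t * f t) =
      (\<Sum>i<m. a i * (LBINT t=real i * h..real (Suc i) * h. f t))" if "m \<le> n" for m
    using that
  proof (induction m)
    case (Suc m)
    have le: "real m * h \<le> real (Suc m) * h" "0 \<le> real m * h" using h by (auto simp: mult_right_mono)
    have "real (Suc m) * h \<le> real n * h" using Suc.prems h by (intro mult_right_mono) auto
    then have T': "real (Suc m) * h \<le> T" using h by simp
    have "interval_lebesgue_integrable lborel (ereal 0) (ereal (real (Suc m) * h)) (\<lambda>t. u t * f t)"
      unfolding interval_lebesgue_integrable_def einterval_eq
      using le T' by (auto intro!: set_integrable_subset[OF int])
    \<comment> \<open>These equations bring the integrability side condition of
      \<open>interval_integral_sum\<close> into the form just proved.\<close>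
    moreover have "min (ereal 0) (min (ereal (real m * h)) (ereal (real (Suc m) * h))) = ereal 0"
      "max (ereal 0) (max (ereal (real m * h)) (ereal (real (Suc m) * h))) = ereal (real (Suc m) * h)"
      using le by (simp_all add: min_absorb1 max_absorb2)
    ultimately have "(LBINT t=0..real (Suc m) * h. u t * f t) =
        (LBINT t=0..real m * h. u t * f t) + (LBINT t=real m * h..real (Suc m) * h. u t * f t)"
      unfolding zero_ereal_def by (intro interval_integral_sum[symmetric]) presburger
    also have "(LBINT t=real m * h..real (Suc m) * h. u t * f t) =
        (LBINT t=real m * h..real (Suc m) * h. a m * f t)"
    proof (rule interval_integral_cong)
      fix t assume "t \<in> einterval (min (ereal (real m * h)) (ereal (real (Suc m) * h)))
                        (max (ereal (real m * h)) (ereal (real (Suc m) * h)))"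
      then have "t \<in> {real m * h<..<real (Suc m) * h}"
        using le by (simp add: min_absorb1 max_absorb2 einterval_eq del: of_nat_Suc)
      then show "u t * f t = a m * f t"
        using u Suc.prems by (simp add: has_step_values_def h_def)
    qed
    finally show ?case using Suc by simp
  qed (simp add: zero_ereal_def)
  from this[OF order_refl] show ?thesis using T h by (simp add: L2_inner_interval h_def)
qed

lemma L2_norm_step:
  assumes T: "0 < T" and n: "n \<ge> 1" and u: "has_step_values T n u a"
  shows "(L2_norm T u)\<^sup>2 = T / real n * (\<Sum>i<n. (a i)\<^sup>2)"
proof -
  define h where "h = T / real n"
  have h: "0 < h" using T n by (simp add: h_def)
  have "(LBINT t=real i * h..real (Suc i) * h. u t) = a i * h" if i: "i < n" for i
  proof -
    have le: "real i * h \<le> real (Suc i) * h" using h by (auto simp: mult_right_mono)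
    have "(LBINT t=real i * h..real (Suc i) * h. u t) = (LBINT t=real i * h..real (Suc i) * h. a i)"
    proof (rule interval_integral_cong)
      fix t assume "t \<in> einterval (min (ereal (real i * h)) (ereal (real (Suc i) * h)))
                        (max (ereal (real i * h)) (ereal (real (Suc i) * h)))"
      then have "t \<in> {real i * h<..<real (Suc i) * h}"
        using le by (simp add: min_absorb1 max_absorb2 einterval_eq del: of_nat_Suc)
      then show "u t = a i" using u i by (simp add: has_step_values_def h_def)
    qed
    then show ?thesis by (simp add: algebra_simps)
  qed
  moreover have "u \<in> L2_space T" using u by (simp add: has_step_values_def)
  ultimately show ?thesis
    unfolding L2_norm_squared L2_inner_step[OF T n u \<open>u \<in> L2_space T\<close>]
    by (simp add: h_def sum_distrib_left power2_eq_square mult_ac flip: of_nat_Suc)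
qed

section \<open>Fourier coefficients of step functions\<close>

text \<open>Half of the phase \<open>freq T k * (T / real n)\<close> that mode \<open>k\<close>
  gains across one element.\<close>

definition half_step_angle :: "nat \<Rightarrow> nat \<Rightarrow> real" where
  "half_step_angle n k = pi * (2 * real k + 1) / (4 * real n)"

lemma half_step_angle_pos: "n \<ge> 1 \<Longrightarrow> 0 < half_step_angle n k"
  by (simp add: half_step_angle_def add_nonneg_pos)

text \<open>The phases at the two ends of an element are the midpoint phase plus and minus
  \<open>\<theta>\<close>. The difference of the antiderivatives therefore factors into
  \<open>2 * sin \<theta>\<close> and the midpoint value, and the frequency is
  \<open>2 * \<theta>\<close> divided by the element length.\<close>

lemma mode_step_integrals:
  fixes i k :: nat
  assumes T: "0 < T" and n: "n \<ge> 1"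
  defines "\<theta> \<equiv> half_step_angle n k"
  shows "(LBINT t=real i * (T / real n)..real (Suc i) * (T / real n). cos (freq T k * t)) =
      T / real n * (sin \<theta> / \<theta>) * cos (grid_angle n k i)"
    and "(LBINT t=real i * (T / real n)..real (Suc i) * (T / real n). sin (freq T k * t)) =
      T / real n * (sin \<theta> / \<theta>) * sin (grid_angle n k i)"
proof -
  have \<theta>: "0 < \<theta>" unfolding \<theta>_def by (rule half_step_angle_pos[OF n])
  have w: "freq T k = 2 * \<theta> / (T / real n)"
    using T n by (simp add: freq_def \<theta>_def half_step_angle_def field_simps)
  then have w0: "freq T k \<noteq> 0" using \<theta> T n by simp
  have b: "freq T k * (real (Suc i) * (T / real n)) = grid_angle n k i + \<theta>"
    and a: "freq T k * (real i * (T / real n)) = grid_angle n k i - \<theta>"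
    using T n by (auto simp: freq_def \<theta>_def half_step_angle_def grid_angle_def field_simps)
  show "(LBINT t=real i * (T / real n)..real (Suc i) * (T / real n). cos (freq T k * t)) =
      T / real n * (sin \<theta> / \<theta>) * cos (grid_angle n k i)"
    unfolding interval_integral_cos[OF w0] a b using \<theta> T n
    by (simp add: sin_add sin_diff w field_simps)
  show "(LBINT t=real i * (T / real n)..real (Suc i) * (T / real n). sin (freq T k * t)) =
      T / real n * (sin \<theta> / \<theta>) * sin (grid_angle n k i)"
    unfolding interval_integral_sin[OF w0] a b using \<theta> T n
    by (simp add: cos_add cos_diff w field_simps)
qed

lemma step_coefficients:
  assumes T: "0 < T" and n: "n \<ge> 1" and u: "has_step_values T n u a"
  defines "\<theta> \<equiv> half_step_angle n"
  shows "cos_coeff_T T u k = 2 / real n * (sin (\<theta> k) / \<theta> k) * (\<Sum>i<n. a i * cos (grid_angle n k i))"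
    and "sin_coeff_T T u k = 2 / real n * (sin (\<theta> k) / \<theta> k) * (\<Sum>i<n. a i * sin (grid_angle n k i))"
proof -
  have "cos_coeff_T T u k = 2 / T * L2_inner T u (\<lambda>t. cos (freq T k * t))"
    by (simp add: cos_coeff_T_def L2_inner_def)
  also have "\<dots> = 2 / T * (\<Sum>i<n. a i * (T / real n * (sin (\<theta> k) / \<theta> k) * cos (grid_angle n k i)))"
    unfolding L2_inner_step[OF T n u cos_mode_L2] mode_step_integrals[OF T n] \<theta>_def ..
  also have "\<dots> = 2 / real n * (sin (\<theta> k) / \<theta> k) * (\<Sum>i<n. a i * cos (grid_angle n k i))"
    using T unfolding sum_distrib_left by (intro sum.cong refl) simp
  finally show "cos_coeff_T T u k = \<dots>" .
  have sin_L2: "(\<lambda>t. sin (freq T k * t)) \<in> L2_space T"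
    by (rule L2_space_continuous_bounded[where B=1]) (auto intro!: continuous_intros)
  have "sin_coeff_T T u k = 2 / T * L2_inner T u (\<lambda>t. sin (freq T k * t))"
    by (simp add: sin_coeff_T_def L2_inner_def)
  also have "\<dots> = 2 / T * (\<Sum>i<n. a i * (T / real n * (sin (\<theta> k) / \<theta> k) * sin (grid_angle n k i)))"
    unfolding L2_inner_step[OF T n u sin_L2] mode_step_integrals[OF T n] \<theta>_def ..
  also have "\<dots> = 2 / real n * (sin (\<theta> k) / \<theta> k) * (\<Sum>i<n. a i * sin (grid_angle n k i))"
    using T unfolding sum_distrib_left by (intro sum.cong refl) simp
  finally show "sin_coeff_T T u k = \<dots>" .
qed

text \<open>The sampled sums are bounded by \<open>B\<close> uniformly in \<open>k\<close>, and the
  damping factor decays like \<open>1 / k\<close>, so the squares are dominated by a multiple of the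
  inverse squares.\<close>

lemma step_sin_coeff_summable:
  assumes T: "0 < T" and n: "n \<ge> 1" and v: "has_step_values T n v b"
  shows "summable (\<lambda>k. (sin_coeff_T T v k)\<^sup>2)"
proof -
  define B where "B = (\<Sum>i<n. \<bar>b i\<bar>)"
  have bound: "norm ((sin_coeff_T T v k)\<^sup>2) \<le> (8 * B / pi)\<^sup>2 * inverse (real (Suc k) ^ 2)" for k
  proof -
    let ?\<theta> = "half_step_angle n k"
    have \<theta>: "0 < ?\<theta>" by (rule half_step_angle_pos[OF n])
    have "\<bar>\<Sum>i<n. b i * sin (grid_angle n k i)\<bar> \<le> B"
      unfolding B_def
      by (rule order_trans[OF sum_abs]) (auto intro!: sum_mono mult_left_le simp: abs_mult)
    then have "\<bar>sin_coeff_T T v k\<bar> \<le> 2 / real n * (1 / ?\<theta>) * B"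
      unfolding step_coefficients[OF T n v] abs_mult using \<theta> n
      by (intro mult_mono) (auto simp: divide_right_mono)
    also have "\<dots> \<le> 2 / real n * (4 * real n / (pi * real (Suc k))) * B"
    proof (intro mult_right_mono mult_left_mono)
      have "pi * real (Suc k) \<le> pi * (2 * real k + 1)" by (intro mult_left_mono) auto
      then show "1 / ?\<theta> \<le> 4 * real n / (pi * real (Suc k))"
        using n by (simp add: half_step_angle_def frac_le)
    qed (use n in \<open>auto simp: B_def sum_nonneg\<close>)
    also have "\<dots> = 8 * B / pi * inverse (real (Suc k))" using n by (simp add: field_simps)
    finally have "\<bar>sin_coeff_T T v k\<bar>\<^sup>2 \<le> (8 * B / pi * inverse (real (Suc k)))\<^sup>2"
      by (intro power_mono) auto
    then show ?thesis by (simp add: power_mult_distrib power_divide power_inverse)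
  qed
  have "summable (\<lambda>k. inverse (real (Suc k) ^ 2))"
    using inverse_power_summable[of 2, where 'a=real]
    by (subst summable_Suc_iff[of "\<lambda>k. inverse (real k ^ 2)"]) simp
  then have "summable (\<lambda>k. (8 * B / pi)\<^sup>2 * inverse (real (Suc k) ^ 2))" by (rule summable_mult)
  then show ?thesis by (rule summable_comparison_test'[where N=0]) (rule bound)
qed

subsection \<open>The inf-sup constant\<close>

text \<open>The constant \<open>c_S\<close> as a function of the index \<open>m\<close> alone. The
  squared ratio is that of \<open>half_step_angle n m\<close> to its complement to
  \<open>pi\<close>, which is how the constant meets the mode weights.\<close>

definition c_S_value :: "nat \<Rightarrow> nat \<Rightarrow> real" where
  "c_S_value n m = 2 * sqrt 3 / pi\<^sup>2 * (1 - ((2 * real m + 1) / (4 * real n - (2 * real m + 1)))\<^sup>2)"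

lemma c_S_eq_value:
  assumes "M_index T u < n"
  shows "c_S T n u = c_S_value n (M_index T u)"
proof -
  have "2 * real (M_index T u) + 1 < 4 * real n" using assms by linarith
  from diff_square_quotient[OF this] show ?thesis
    by (simp add: c_S_def c_S_value_def power_mult_distrib mult_ac)
qed

text \<open>As \<open>m\<close> grows, the numerator of the ratio increases and its denominator
  decreases while staying positive.\<close>

lemma c_S_value_strict_antimono:
  assumes "l < m" "m < n"
  shows "c_S_value n m < c_S_value n l"
proof -
  let ?r = "\<lambda>m. (2 * real m + 1) / (4 * real n - (2 * real m + 1))"
  have "?r l < ?r m"
    by (rule frac_less) (use assms in auto)
  moreover have "0 \<le> ?r l" using assms by simp
  ultimately have "(?r l)\<^sup>2 < (?r m)\<^sup>2" by (intro power_strict_mono) auto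
  then show ?thesis unfolding c_S_value_def by (intro mult_strict_left_mono) auto
qed

lemma c_S_value_antimono: "l \<le> m \<Longrightarrow> m < n \<Longrightarrow> c_S_value n m \<le> c_S_value n l"
  using c_S_value_strict_antimono[of l m n] by (cases "l = m") auto

lemma c_S_value_last:
  assumes "n \<ge> 1"
  shows "c_S_value n (n - 1) = 2 * sqrt 3 / pi\<^sup>2 * (8 / (2 + 1 / real n)\<^sup>2) / real n"
proof -
  have n: "real (n - 1) = real n - 1" "real n \<noteq> 0" using assms by auto
  have p: "2 * real n + 1 \<noteq> 0" by linarith
  have "1 - ((2 * real (n - 1) + 1) / (4 * real n - (2 * real (n - 1) + 1)))\<^sup>2 =
      1 - ((2 * real n - 1) / (2 * real n + 1))\<^sup>2" unfolding n by simp
  also have "\<dots> = 8 * real n / (2 * real n + 1)\<^sup>2"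
    using p by (simp add: power_divide divide_simps) (simp add: power2_eq_square algebra_simps)
  also have "\<dots> = 8 / (2 + 1 / real n)\<^sup>2 / real n"
  proof -
    have "2 + 1 / real n = (2 * real n + 1) / real n" using n by (simp add: field_simps)
    then show ?thesis using n p by (simp add: power_divide power2_eq_square)
  qed
  finally show ?thesis by (simp add: c_S_value_def)
qed

lemma half_step_angle_lt: "k < n \<Longrightarrow> half_step_angle n k < pi / 2"
proof -
  assume k: "k < n"
  then have "2 * real k + 1 < 2 * real n" by linarith
  then have "pi * (2 * real k + 1) < pi * (2 * real n)" by (intro mult_strict_left_mono) auto
  then show ?thesis using k by (simp add: half_step_angle_def field_simps)
qed

lemma sinc_half_step_lower:
  assumes "k < n"
  shows "4 / pi\<^sup>2 \<le> (sin (half_step_angle n k) / half_step_angle n k)\<^sup>2"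
proof -
  let ?\<theta> = "half_step_angle n k"
  have \<theta>: "0 < ?\<theta>" "?\<theta> < pi / 2" using assms half_step_angle_pos half_step_angle_lt by auto
  then have "2 / pi \<le> sin ?\<theta> / ?\<theta>"
    using sin_ge_two_over_pi[of ?\<theta>] by (simp add: pos_le_divide_eq)
  then have "(2 / pi)\<^sup>2 \<le> (sin ?\<theta> / ?\<theta>)\<^sup>2" by (intro power_mono) auto
  then show ?thesis by (simp add: power_divide)
qed

text \<open>The right-hand side is the weight of the pair of modes \<open>k\<close> and
  \<open>2n - 1 - k\<close>. Factoring out the squared \<open>sin \<theta> / \<theta>\<close>, which
  is at least \<open>4 / pi\<^sup>2\<close>, leaves exactly the bracket in
  \<open>c_S_value\<close>.\<close>

lemma mode_weight_lower:
  assumes k: "k < n"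
  defines "\<theta> \<equiv> half_step_angle n k"
  shows "c_S_value n k \<le> (sin \<theta>)\<^sup>2 * (1 / \<theta>\<^sup>2 - 1 / (pi - \<theta>)\<^sup>2)"
proof -
  have \<theta>: "0 < \<theta>" "\<theta> < pi / 2" unfolding \<theta>_def using k half_step_angle_pos half_step_angle_lt by auto
  have "pi - \<theta> = pi * (4 * real n - (2 * real k + 1)) / (4 * real n)"
    using k by (simp add: \<theta>_def half_step_angle_def field_simps)
  then have ratio: "\<theta> / (pi - \<theta>) = (2 * real k + 1) / (4 * real n - (2 * real k + 1))"
    using k by (simp add: \<theta>_def half_step_angle_def)
  \<comment> \<open>The constant \<open>2 * sqrt 3\<close> thus lies below the 4 that Jordan's
    inequality provides.\<close>
  have "sqrt 3 \<le> 2" by (rule real_le_lsqrt) auto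
  then have "2 * sqrt 3 / pi\<^sup>2 \<le> 4 / pi\<^sup>2" by (intro divide_right_mono) auto
  also have "\<dots> \<le> (sin \<theta> / \<theta>)\<^sup>2" unfolding \<theta>_def by (rule sinc_half_step_lower[OF k])
  finally have "2 * sqrt 3 / pi\<^sup>2 * (1 - (\<theta> / (pi - \<theta>))\<^sup>2) \<le> (sin \<theta> / \<theta>)\<^sup>2 * (1 - (\<theta> / (pi - \<theta>))\<^sup>2)"
  proof (rule mult_right_mono)
    have "\<theta> / (pi - \<theta>) \<le> 1" "0 \<le> \<theta> / (pi - \<theta>)" using \<theta> by auto
    then show "0 \<le> 1 - (\<theta> / (pi - \<theta>))\<^sup>2" by (simp add: power_le_one)
  qed
  also have "\<dots> = (sin \<theta>)\<^sup>2 * (1 / \<theta>\<^sup>2 - 1 / (pi - \<theta>)\<^sup>2)"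
    using \<theta> by (simp add: power_divide right_diff_distrib)
  finally show ?thesis by (simp add: c_S_value_def ratio)
qed

text \<open>Raising the mode by \<open>2n\<close> adds \<open>pi\<close> to the angle, and
  \<open>2n - 1 - k\<close> replaces \<open>2k + 1\<close> by \<open>4n - (2k + 1)\<close>, that is,
  the angle by its complement to \<open>pi\<close>.\<close>

lemma half_step_angle_aliases:
  assumes "k < n"
  shows "half_step_angle n (2 * n * l + k) = real l * pi + half_step_angle n k"
    and "half_step_angle n (2 * n * l + (2 * n - 1 - k)) = real (Suc l) * pi - half_step_angle n k"
proof -
  show "half_step_angle n (2 * n * l + k) = real l * pi + half_step_angle n k"
    using assms by (simp add: half_step_angle_def field_simps)
  have "real (2 * n * l + (2 * n - 1 - k)) = 2 * real n * real l + (2 * real n - 1 - real k)"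
    using assms by (simp add: of_nat_diff)
  then show "half_step_angle n (2 * n * l + (2 * n - 1 - k)) = real (Suc l) * pi - half_step_angle n k"
    unfolding half_step_angle_def using assms by (simp only:) (simp add: field_simps)
qed

lemma sin_squared_npi:
  "(sin (real m * pi + x))\<^sup>2 = (sin x)\<^sup>2" "(sin (real m * pi - x))\<^sup>2 = (sin x)\<^sup>2"
  using cos_sin_add_npi(2)[of x m] cos_sin_add_npi(4)[of m x]
  by (simp_all add: add.commute power_mult_distrib flip: power_mult)

lemma sum_lessThan_add:
  fixes F :: "nat \<Rightarrow> real"
  shows "(\<Sum>k<m + n. F k) = (\<Sum>k<m. F k) + (\<Sum>k<n. F (m + k))"
  by (induction n) simp_all

text \<open>Folds the upper half of a block of \<open>2n\<close> modes onto the lower half, so that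
  aliases which are reflections of each other stand together.\<close>

lemma sum_reflected_pairs:
  fixes F :: "nat \<Rightarrow> real"
  shows "(\<Sum>k<2 * n. F k) = (\<Sum>k<n. F k + F (2 * n - 1 - k))"
proof -
  have "(\<Sum>k<2 * n. F k) = (\<Sum>k<n. F k) + (\<Sum>k<n. F (n + k))"
    unfolding mult_2 by (rule sum_lessThan_add)
  also have "(\<Sum>k<n. F (n + k)) = (\<Sum>k<n. F (n + (n - Suc k)))"
    by (rule sum.nat_diff_reindex[symmetric])
  also have "\<dots> = (\<Sum>k<n. F (2 * n - 1 - k))" by (intro sum.cong refl) (auto intro!: arg_cong[where f=F])
  finally show ?thesis by (simp add: sum.distrib)
qed

text \<open>The hypothesis \<open>transfer\<close> makes the leading products of cosine and sine
  sums into squares. Grouped in blocks of \<open>2n\<close> modes, the series has nonnegative block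
  sums, so its limit is at least its first block.\<close>

lemma modified_Hilbert_step_lower:
  assumes T: "0 < T" and n: "n \<ge> 1"
    and u: "has_step_values T n u a" and v: "has_step_values T n v b"
    and transfer: "\<And>k. k < n \<Longrightarrow>
      (\<Sum>i<n. b i * sin (grid_angle n k i)) = (\<Sum>i<n. a i * cos (grid_angle n k i))"
  shows "c_S_value n (n - 1) * (L2_norm T u)\<^sup>2 \<le> L2_inner T u (modified_Hilbert T v)"
proof -
  define \<theta> where "\<theta> = half_step_angle n"
  define A where "A k = (\<Sum>i<n. a i * cos (grid_angle n k i))" for k
  define B where "B k = (\<Sum>i<n. b i * sin (grid_angle n k i))" for k
  define F where "F k = (sin (\<theta> k) / \<theta> k)\<^sup>2 * (A k * B k)" for k
  define S where "S N = (\<Sum>k<N. F k)" for N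
  have \<theta>: "0 < \<theta> k" "\<theta> k < pi / 2" if "k < n" for k
    unfolding \<theta>_def using that half_step_angle_pos half_step_angle_lt by auto
  have BA: "B k = A k" if "k < n" for k using transfer[OF that] by (simp add: A_def B_def)

  have "cos_coeff_T T u k * sin_coeff_T T v k = 4 / (real n)\<^sup>2 * F k" for k
    by (simp add: step_coefficients[OF T n u] step_coefficients[OF T n v] F_def A_def B_def \<theta>_def
        power2_eq_square mult_ac)
  then have partial: "T / 2 * (\<Sum>k<N. cos_coeff_T T u k * sin_coeff_T T v k) = 2 * T / (real n)\<^sup>2 * S N" for N
    unfolding S_def by (simp flip: sum_distrib_left sum_divide_distrib)
  have "u \<in> L2_space T" using u by (simp add: has_step_values_def)
  from modified_Hilbert_inner[OF T this step_sin_coeff_summable[OF T n v]]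
  have lim: "(\<lambda>N. 2 * T / (real n)\<^sup>2 * S N) \<longlonglongrightarrow> L2_inner T u (modified_Hilbert T v)"
    by (simp only: partial)

  have pair: "F (2 * n * l + k) + F (2 * n * l + (2 * n - 1 - k)) =
      (A k)\<^sup>2 * ((sin (\<theta> k))\<^sup>2 * (1 / (real l * pi + \<theta> k)\<^sup>2 - 1 / (real (Suc l) * pi - \<theta> k)\<^sup>2))"
    if k: "k < n" for l k
  proof -
    have "A (2 * n * l + k) = (-1) ^ l * A k" "B (2 * n * l + k) = (-1) ^ l * B k"
      "A (2 * n * l + (2 * n - 1 - k)) = - ((-1) ^ l * A k)"
      "B (2 * n * l + (2 * n - 1 - k)) = (-1) ^ l * B k"
      unfolding A_def B_def grid_aliasing[OF n k]
      by (simp_all only: sum_distrib_left sum_negf[symmetric])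
         (simp_all add: mult_ac)
    then have "A (2 * n * l + k) * B (2 * n * l + k) = (A k)\<^sup>2"
      "A (2 * n * l + (2 * n - 1 - k)) * B (2 * n * l + (2 * n - 1 - k)) = - (A k)\<^sup>2"
      using BA[OF k] by (simp_all only: power2_eq_square) (simp_all add: flip: power_add)
    then show ?thesis
      unfolding F_def \<theta>_def half_step_angle_aliases[OF k]
      by (simp only: power_divide sin_squared_npi) (simp add: algebra_simps)
  qed
  \<comment> \<open>Since the angle is below \<open>pi / 2\<close>, the lower alias
    \<open>l * pi + \<theta> k\<close> does not exceed the reflected one, and its inverse square
    dominates.\<close>
  have pair_nonneg: "0 \<le> F (2 * n * l + k) + F (2 * n * l + (2 * n - 1 - k))" if k: "k < n" for l k
  proof -
    have "0 < real l * pi + \<theta> k" using \<theta>[OF k] by (simp add: add_nonneg_pos)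
    moreover have "real l * pi + \<theta> k \<le> real (Suc l) * pi - \<theta> k"
      using \<theta>[OF k] by (simp add: algebra_simps)
    ultimately have "1 / (real (Suc l) * pi - \<theta> k)\<^sup>2 \<le> 1 / (real l * pi + \<theta> k)\<^sup>2"
      by (intro divide_left_mono power_mono) auto
    then show ?thesis unfolding pair[OF k] by simp
  qed
  have block: "(\<Sum>k<2 * n. F (2 * n * l + k)) =
      (\<Sum>k<n. F (2 * n * l + k) + F (2 * n * l + (2 * n - 1 - k)))" for l
    by (rule sum_reflected_pairs)
  have "0 \<le> (\<Sum>k<2 * n. F (2 * n * l + k))" for l
    unfolding block by (intro sum_nonneg pair_nonneg) simp
  moreover have "S (2 * n * Suc l) = S (2 * n * l) + (\<Sum>k<2 * n. F (2 * n * l + k))" for l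
    unfolding S_def sum_lessThan_add[symmetric] by (simp add: algebra_simps)
  ultimately have mono: "S (2 * n * l) \<le> S (2 * n * Suc l)" for l by simp
  have "incseq (\<lambda>l. S (2 * n * Suc l))" by (rule incseq_SucI) (rule mono)

  have Parseval: "(\<Sum>k<n. (A k)\<^sup>2) = real n / 2 * (\<Sum>i<n. (a i)\<^sup>2)"
    unfolding A_def
    by (rule grid_Parseval[where Q="\<lambda>k i. cos (grid_angle n k i)"]) (use n grid_cos_orthogonal in auto)
  have "c_S_value n (n - 1) * (L2_norm T u)\<^sup>2 =
      2 * T / (real n)\<^sup>2 * (\<Sum>k<n. (A k)\<^sup>2 * c_S_value n (n - 1))"
    unfolding L2_norm_step[OF T n u] sum_distrib_right[symmetric] Parseval using n
    by (simp add: power2_eq_square)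
  also have "\<dots> \<le> 2 * T / (real n)\<^sup>2 * S (2 * n)"
  proof (rule mult_left_mono)
    \<comment> \<open>The first block treats each mode with its own constant
      \<open>c_S_value n k\<close>; monotonicity replaces it by the smallest one, at
      \<open>n - 1\<close>.\<close>
    have "(A k)\<^sup>2 * c_S_value n (n - 1) \<le> F k + F (2 * n - 1 - k)" if k: "k < n" for k
    proof -
      have "c_S_value n (n - 1) \<le> c_S_value n k" using k by (intro c_S_value_antimono) auto
      also have "\<dots> \<le> (sin (\<theta> k))\<^sup>2 * (1 / (\<theta> k)\<^sup>2 - 1 / (pi - \<theta> k)\<^sup>2)"
        unfolding \<theta>_def by (rule mode_weight_lower[OF k])
      finally show ?thesis using pair[OF k, of 0] by (simp add: mult_left_mono)
    qed
    then show "(\<Sum>k<n. (A k)\<^sup>2 * c_S_value n (n - 1)) \<le> S (2 * n)"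
      unfolding S_def sum_reflected_pairs by (intro sum_mono) auto
  qed (use T in simp)
  also have "\<dots> \<le> L2_inner T u (modified_Hilbert T v)"
  proof (rule LIMSEQ_le_const)
    \<comment> \<open>The limit is taken along complete blocks only, where the partial sums are
      known to increase.\<close>
    have "strict_mono (\<lambda>l. 2 * n * Suc l)" using n by (simp add: strict_mono_Suc_iff)
    from LIMSEQ_subseq_LIMSEQ[OF lim this]
    show "(\<lambda>l. 2 * T / (real n)\<^sup>2 * S (2 * n * Suc l)) \<longlonglongrightarrow> L2_inner T u (modified_Hilbert T v)"
      by (simp add: o_def)
    show "\<exists>N. \<forall>l\<ge>N. 2 * T / (real n)\<^sup>2 * S (2 * n) \<le> 2 * T / (real n)\<^sup>2 * S (2 * n * Suc l)"
      using incseqD[OF \<open>incseq (\<lambda>l. S (2 * n * Suc l))\<close>, of 0] T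
      by (intro exI[of _ 0] allI impI mult_left_mono) auto
  qed
  finally show ?thesis .
qed

text \<open>A single admissible \<open>v\<close> whose quotient reaches the bound is enough for the
  supremum.\<close>

lemma inf_sup_bound:
  assumes T: "0 < T" and n: "n \<ge> 1" and u: "u \<in> step_space T n"
  shows "ereal (c_S_value n (n - 1) * L2_norm T u) \<le>
    (SUP v\<in>{v \<in> step_space T n. L2_norm T v \<noteq> 0}.
       ereal (L2_inner T u (modified_Hilbert T v) / L2_norm T v))"
proof -
  obtain a where a: "has_step_values T n u a" using u step_space_iff by blast
  have "\<exists>v\<in>{v \<in> step_space T n. L2_norm T v \<noteq> 0}.
      c_S_value n (n - 1) * L2_norm T u \<le> L2_inner T u (modified_Hilbert T v) / L2_norm T v"
  proof (cases "L2_norm T u = 0")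
    case True
    \<comment> \<open>If \<open>u\<close> vanishes in the space, any nonzero \<open>v\<close>
      serves; the constant 1 is taken, and Cauchy-Schwarz makes the quotient 0.\<close>
    obtain v where v: "has_step_values T n v (\<lambda>_. 1)" using ex_step_values[OF T] by blast
    have "(L2_norm T v)\<^sup>2 = T" using L2_norm_step[OF T n v] n by simp
    then have v0: "L2_norm T v \<noteq> 0" using T by auto
    have "\<bar>L2_inner T u (modified_Hilbert T v)\<bar> \<le> L2_norm T u * L2_norm T (modified_Hilbert T v)"
      using a modified_Hilbert_converges(1)[OF T step_sin_coeff_summable[OF T n v]]
      by (intro L2_Cauchy_Schwarz) (auto simp: has_step_values_def)
    then have "L2_inner T u (modified_Hilbert T v) = 0" using True by simp
    then show ?thesis using v v0 True step_space_iff by auto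
  next
    case False
    obtain b where b: "\<And>k. k < n \<Longrightarrow>
        (\<Sum>i<n. b i * sin (grid_angle n k i)) = (\<Sum>i<n. a i * cos (grid_angle n k i))"
      and norm: "(\<Sum>i<n. (b i)\<^sup>2) = (\<Sum>i<n. (a i)\<^sup>2)"
      using grid_cos_sin_transfer[OF n, of a] by blast
    obtain v where v: "has_step_values T n v b" using ex_step_values[OF T] by blast
    \<comment> \<open>Equal norms let the division by the norm of \<open>v\<close> turn the squared
      norm of \<open>u\<close> into the norm itself.\<close>
    have "L2_norm T v = L2_norm T u"
      by (rule power2_eq_imp_eq) (simp_all add: L2_norm_step[OF T n v] L2_norm_step[OF T n a] norm L2_norm_nonneg)
    moreover have "c_S_value n (n - 1) * (L2_norm T u)\<^sup>2 \<le> L2_inner T u (modified_Hilbert T v)"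
      by (rule modified_Hilbert_step_lower[OF T n a v b])
    moreover have "0 < L2_norm T u" using False L2_norm_nonneg[of T u] by simp
    ultimately show ?thesis
      using v step_space_iff by (intro bexI[of _ v]) (auto simp: pos_le_divide_eq power2_eq_square mult_ac)
  qed
  then show ?thesis by (auto intro: SUP_upper2)
qed

section \<open>The index M and the minimum of the constants\<close>

text \<open>The index \<open>n - 1\<close> satisfies the defining inequality, so the
  \<open>LEAST\<close> exists, inherits the inequality, and is at most \<open>n - 1\<close>.\<close>

lemma M_index_step:
  assumes T: "0 < T" and n: "n \<ge> 1" and u: "u \<in> step_space T n"
  shows M_index_less: "M_index T u < n"
    and M_index_bound: "(L2_norm T u)\<^sup>2 \<le>
      T / 2 * (pi\<^sup>2 / 3) * (\<Sum>k\<le>M_index T u. (cos_coeff_T T u k)\<^sup>2)"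
proof -
  obtain a where a: "has_step_values T n u a" using u step_space_iff by blast
  let ?A = "\<lambda>k. \<Sum>i<n. a i * cos (grid_angle n k i)"
  have Parseval: "(\<Sum>k<n. (?A k)\<^sup>2) = real n / 2 * (\<Sum>i<n. (a i)\<^sup>2)"
    by (rule grid_Parseval[where Q="\<lambda>k i. cos (grid_angle n k i)"]) (use n grid_cos_orthogonal in auto)
  have "(2 / real n)\<^sup>2 * (4 / pi\<^sup>2) * (?A k)\<^sup>2 \<le> (cos_coeff_T T u k)\<^sup>2" if "k < n" for k
    unfolding step_coefficients[OF T n a] power_mult_distrib[of "_ * _"] power_mult_distrib[of "2 / real n"]
    using sinc_half_step_lower[OF that] by (intro mult_right_mono mult_left_mono) auto
  then have "(\<Sum>k<n. (2 / real n)\<^sup>2 * (4 / pi\<^sup>2) * (?A k)\<^sup>2) \<le> (\<Sum>k<n. (cos_coeff_T T u k)\<^sup>2)"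
    by (intro sum_mono) auto
  then have *: "T / 2 * (pi\<^sup>2 / 3) * ((2 / real n)\<^sup>2 * (4 / pi\<^sup>2) * (real n / 2 * (\<Sum>i<n. (a i)\<^sup>2)))
      \<le> T / 2 * (pi\<^sup>2 / 3) * (\<Sum>k<n. (cos_coeff_T T u k)\<^sup>2)"
    unfolding sum_distrib_left[symmetric] Parseval using T by (intro mult_left_mono) auto
  \<comment> \<open>The factor 4/3 is \<open>pi\<^sup>2 / 3\<close> times the lower bound
    \<open>4 / pi\<^sup>2\<close> for the damping.\<close>
  have "(L2_norm T u)\<^sup>2 \<le> 4 / 3 * (L2_norm T u)\<^sup>2" by simp
  also have "\<dots> = T / 2 * (pi\<^sup>2 / 3) * ((2 / real n)\<^sup>2 * (4 / pi\<^sup>2) * (real n / 2 * (\<Sum>i<n. (a i)\<^sup>2)))"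
    unfolding L2_norm_step[OF T n a] using n by (simp add: field_simps power2_eq_square)
  also note *
  also have "{..<n} = {..n - 1}" using n by auto
  finally have le: "(L2_norm T u)\<^sup>2 \<le> T / 2 * (pi\<^sup>2 / 3) * (\<Sum>k\<le>n - 1. (cos_coeff_T T u k)\<^sup>2)" .
  then have "M_index T u \<le> n - 1" unfolding M_index_def by (rule Least_le)
  then show "M_index T u < n" using n by simp
  from le show "(L2_norm T u)\<^sup>2 \<le> T / 2 * (pi\<^sup>2 / 3) * (\<Sum>k\<le>M_index T u. (cos_coeff_T T u k)\<^sup>2)"
    unfolding M_index_def by (rule LeastI)
qed

text \<open>For the sampled cosine of mode \<open>n - 1\<close>, orthogonality annihilates all
  coefficients below \<open>n - 1\<close>. Partial sums ending earlier vanish and cannot dominate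
  the positive norm.\<close>

lemma ex_M_index_last:
  assumes T: "0 < T" and n: "n \<ge> 1"
  shows "\<exists>u\<in>step_space T n. M_index T u = n - 1"
proof -
  obtain u where u: "has_step_values T n u (\<lambda>i. cos (grid_angle n i (n - 1)))"
    using ex_step_values[OF T] by blast
  then have us: "u \<in> step_space T n" using step_space_iff by blast
  have zero: "cos_coeff_T T u k = 0" if "k < n - 1" for k
    unfolding step_coefficients[OF T n u] grid_angle_commute[of n k]
    using grid_cos_orthogonal[of n "n - 1" k] that by simp
  have "(\<Sum>i<n. (cos (grid_angle n i (n - 1)))\<^sup>2) = real n / 2"
    using grid_cos_orthogonal[of n "n - 1" "n - 1"] n by (simp add: power2_eq_square)
  then have "(L2_norm T u)\<^sup>2 = T / real n * (real n / 2)"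
    unfolding L2_norm_step[OF T n u] by (simp only:)
  moreover have "0 < T / real n * (real n / 2)" using T n by simp
  ultimately have pos: "0 < (L2_norm T u)\<^sup>2" by (simp only:)
  have "n - 1 \<le> M_index T u"
  proof (rule ccontr)
    assume "\<not> n - 1 \<le> M_index T u"
    then have "(\<Sum>k\<le>M_index T u. (cos_coeff_T T u k)\<^sup>2) = 0" by (simp add: zero)
    moreover have "(L2_norm T u)\<^sup>2 \<le> T / 2 * (pi\<^sup>2 / 3) * (\<Sum>k\<le>M_index T u. (cos_coeff_T T u k)\<^sup>2)"
      by (rule M_index_bound[OF T n us])
    ultimately show False using pos by simp
  qed
  then show ?thesis using M_index_less[OF T n us] us by (intro bexI[of _ u]) auto
qed

text \<open>On step functions \<open>c_S\<close> depends on \<open>u\<close> only through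
  \<open>M_index\<close>, which is below \<open>n\<close>, and decreases strictly in it. The value
  at \<open>n - 1\<close> is attained, so the \<open>LEAST\<close> over the reals is well defined,
  and strictness characterises the minimisers.\<close>

lemma c_S_min_eq:
  assumes T: "0 < T" and n: "n \<ge> 1"
  shows "c_S_min T n = c_S_value n (n - 1)"
    and "c_S_min T n \<in> c_S T n ` step_space T n"
    and "u \<in> step_space T n \<Longrightarrow> c_S_min T n \<le> c_S T n u"
    and "u \<in> step_space T n \<Longrightarrow> c_S T n u = c_S_min T n \<longleftrightarrow> M_index T u = n - 1"
proof -
  have val: "c_S T n u = c_S_value n (M_index T u)" if "u \<in> step_space T n" for u
    by (rule c_S_eq_value[OF M_index_less[OF T n that]])
  have le: "c_S_value n (n - 1) \<le> c_S T n u" if "u \<in> step_space T n" for u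
    unfolding val[OF that] using M_index_less[OF T n that] by (intro c_S_value_antimono) auto
  obtain u0 where u0: "u0 \<in> step_space T n" "M_index T u0 = n - 1" using ex_M_index_last[OF T n] by blast
  have mem: "c_S_value n (n - 1) \<in> c_S T n ` step_space T n"
    using val[OF u0(1)] u0 by (metis image_eqI)
  show eq: "c_S_min T n = c_S_value n (n - 1)"
    unfolding c_S_min_def by (rule Least_equality) (use mem le in auto)
  show "c_S_min T n \<in> c_S T n ` step_space T n" using mem eq by simp
  show "c_S_min T n \<le> c_S T n u" if "u \<in> step_space T n" using le[OF that] eq by simp
  show "c_S T n u = c_S_min T n \<longleftrightarrow> M_index T u = n - 1" if "u \<in> step_space T n"
  proof (cases "M_index T u = n - 1")
    case False
    with M_index_less[OF T n that] have "M_index T u < n - 1" by linarith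
    moreover have "n - 1 < n" using n by simp
    ultimately have "c_S_value n (n - 1) < c_S_value n (M_index T u)"
      by (rule c_S_value_strict_antimono)
    with False show ?thesis by (simp add: val[OF that] eq)
  qed (simp add: val[OF that] eq)
qed

theorem corollary4p7:
  shows "(\<forall>(T::real) (n::nat). T > 0 \<and> n \<ge> 1 \<longrightarrow>
            (\<forall>u\<in>step_space T n.
               ereal (c_S_min T n * L2_norm T u) \<le>
               (SUP v\<in>{v \<in> step_space T n. L2_norm T v \<noteq> 0}.
                  ereal (L2_inner T u (modified_Hilbert T v) / L2_norm T v))) \<and>
            c_S_min T n \<in> c_S T n ` step_space T n \<and>
            (\<forall>u\<in>step_space T n. c_S_min T n \<le> c_S T n u) \<and>
            c_S_min T n =
              1 / T * (2 * sqrt 3 / pi\<^sup>2) * (8 / (2 + 1 / real n)\<^sup>2) * (T / real n) \<and>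
            (\<forall>u\<in>step_space T n. c_S T n u = c_S_min T n \<longleftrightarrow> M_index T u = n - 1)) \<and>
         (\<lambda>n. 1 / 2 * (2 * sqrt 3 / pi\<^sup>2) * (8 / (2 + 1 / real n)\<^sup>2))
            \<longlonglongrightarrow> 2 * sqrt 3 / pi\<^sup>2 \<and>
         \<bar>2 * sqrt 3 / pi\<^sup>2 - 0.351\<bar> < 0.0005"
proof (intro conjI allI impI ballI; (elim conjE)?)
  fix T :: real and n :: nat assume T: "0 < T" and n: "1 \<le> n"
  show "ereal (c_S_min T n * L2_norm T u) \<le>
      (SUP v\<in>{v \<in> step_space T n. L2_norm T v \<noteq> 0}.
         ereal (L2_inner T u (modified_Hilbert T v) / L2_norm T v))" if "u \<in> step_space T n" for u
    unfolding c_S_min_eq(1)[OF T n] by (rule inf_sup_bound[OF T n that])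
  show "c_S_min T n = 1 / T * (2 * sqrt 3 / pi\<^sup>2) * (8 / (2 + 1 / real n)\<^sup>2) * (T / real n)"
    unfolding c_S_min_eq(1)[OF T n] c_S_value_last[OF n] using T by simp
qed (use c_S_min_eq c_S_limit c_S_limit_approx in blast)+

end
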